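(* Let $A$ be a coherent quantale. Then the following are equivalent: (1) $A$ is an $mp$-quantale; (2) for any distinct elements $p,q\in Min(A)$ we have $p\vee q=1$; (3) $R(A)$ is an $mp$-frame; (4) $[\rho(0))_A$ is an $mp$-quantale; (5) the inclusion $Min_F(A)\subseteq Spec_F(A)$ has a flat continuous retraction, i.e. there is a continuous map $Spec_F(A)\to Min_F(A)$ that is the identity on $Min(A)$; (6) $Spec_F(A)$ is a normal space; (7) if $p\in Min(A)$ then $V(p)$ is a closed subset of $Spec_F(A)$.
   Context: A quantale here means a complete lattice $A$ with bottom $0$ and top $1$, with an associative commutative multiplication that distributes over arbitrary joins and has $1$ as unit; a frame is a quantale whose multiplication is the meet. $K(A)$ is the set of compact elements. $A$ is coherent if every element is a join of compact elements, $1\in K(A)$, and $K(A)$ is closed under multiplication. An element $p<1$ is $m$-prime if for all $a,b\in A$, $ab\leq p$ implies $a\leq p$ or $b\leq p$; $Spec(A)$ is the set of $m$-prime elements and $Min(A)$ is the set of minimal elements of $Spec(A)$. $A$ is an $mp$-quantale if for any $p\in Spec(A)$ there exists a unique $q\in Min(A)$ with $q\leq p$; an $mp$-frame is an $mp$-quantale which is a frame. $\rho(a)=\bigwedge\{p\in Spec(A): a\leq p\}$; $R(A)=\{a\in A:\rho(a)=a\}$ is a frame with the order of $A$, joins $\rho(\bigvee a_i)$, meets as in $A$ and bottom $\rho(0)$. For $a\in A$, $[a)_A=\{x\in A: a\leq x\}$ with the order of $A$ and multiplication $x\cdot_a y=xy\vee a$; it is a coherent quantale with bottom $a$ and top $1$.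 For $a\in A$, $V(a)=\{p\in Spec(A): a\leq p\}$. $Spec_F(A)$ is $Spec(A)$ with the flat topology, having $\{V(c): c\in K(A)\}$ as a basis of open sets; $Min_F(A)$ is $Min(A)$ as a subspace of $Spec_F(A)$. A space is normal if any two disjoint closed sets have disjoint open neighbourhoods (no separation axiom for points is assumed). *)

theory Defs
  imports "HOL-Analysis.Analysis" "HOL-Algebra.Complete_Lattice"
begin

text \<open>
  Quantales are carrier-based, on top of the lattice theory of HOL-Algebra, because the quantale
  \<open>A\<close>, its frame of radical elements and its up-sets \<open>[a)\<close> are compared as objects of the same kind.
  The bottom and top elements are \<open>\<bottom>\<close> and \<open>\<top>\<close>; they are allowed to coincide.
\<close>

record 'a quantale_obj = "'a gorder" +
  qmult :: "'a \<Rightarrow> 'a \<Rightarrow> 'a"  (infixl \<open>\<cdot>\<index>\<close> 70)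

locale quantale = complete_lattice A for A (structure) +
  assumes qmult_closed [simp, intro]:
      "\<lbrakk>x \<in> carrier A; y \<in> carrier A\<rbrakk> \<Longrightarrow> x \<cdot> y \<in> carrier A"
    and qmult_assoc:
      "\<lbrakk>x \<in> carrier A; y \<in> carrier A; z \<in> carrier A\<rbrakk> \<Longrightarrow> (x \<cdot> y) \<cdot> z = x \<cdot> (y \<cdot> z)"
    and qmult_comm:
      "\<lbrakk>x \<in> carrier A; y \<in> carrier A\<rbrakk> \<Longrightarrow> x \<cdot> y = y \<cdot> x"
    and qmult_sup_distrib:
      "\<lbrakk>x \<in> carrier A; S \<subseteq> carrier A\<rbrakk> \<Longrightarrow> x \<cdot> (\<Squnion> S) = \<Squnion> ((\<lambda>s. x \<cdot> s) ` S)"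
    and qmult_top:
      "x \<in> carrier A \<Longrightarrow> x \<cdot> \<top> = x"

locale frame = quantale +
  assumes qmult_eq_meet:
    "\<lbrakk>x \<in> carrier A; y \<in> carrier A\<rbrakk> \<Longrightarrow> x \<cdot> y = x \<sqinter> y"

definition compact_elements :: "('a, 'b) gorder_scheme \<Rightarrow> 'a set" where
  "compact_elements A =
    {c \<in> carrier A. \<forall>S \<subseteq> carrier A. c \<sqsubseteq>\<^bsub>A\<^esub> \<Squnion>\<^bsub>A\<^esub> S \<longrightarrow> (\<exists>F \<subseteq> S. finite F \<and> c \<sqsubseteq>\<^bsub>A\<^esub> \<Squnion>\<^bsub>A\<^esub> F)}"

locale coherent_quantale = quantale +
  assumes join_of_compact:
      "a \<in> carrier A \<Longrightarrow> \<exists>S \<subseteq> compact_elements A. a = \<Squnion> S"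
    and top_compact: "\<top> \<in> compact_elements A"
    and compact_qmult:
      "\<lbrakk>c \<in> compact_elements A; d \<in> compact_elements A\<rbrakk> \<Longrightarrow> c \<cdot> d \<in> compact_elements A"

definition m_prime :: "('a, 'b) quantale_obj_scheme \<Rightarrow> 'a \<Rightarrow> bool" where
  "m_prime A p \<longleftrightarrow> p \<in> carrier A \<and> p \<sqsubset>\<^bsub>A\<^esub> \<top>\<^bsub>A\<^esub> \<and>
    (\<forall>a \<in> carrier A. \<forall>b \<in> carrier A. a \<cdot>\<^bsub>A\<^esub> b \<sqsubseteq>\<^bsub>A\<^esub> p \<longrightarrow> a \<sqsubseteq>\<^bsub>A\<^esub> p \<or> b \<sqsubseteq>\<^bsub>A\<^esub> p)"

definition Spec :: "('a, 'b) quantale_obj_scheme \<Rightarrow> 'a set" where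
  "Spec A = {p. m_prime A p}"

definition Min_Spec :: "('a, 'b) quantale_obj_scheme \<Rightarrow> 'a set" where
  "Min_Spec A = {p \<in> Spec A. \<forall>q \<in> Spec A. q \<sqsubseteq>\<^bsub>A\<^esub> p \<longrightarrow> q = p}"

locale mp_quantale = quantale +
  assumes unique_minimal: "p \<in> Spec A \<Longrightarrow> \<exists>!q. q \<in> Min_Spec A \<and> q \<sqsubseteq> p"

locale mp_frame = mp_quantale + frame

definition V_above :: "('a, 'b) quantale_obj_scheme \<Rightarrow> 'a \<Rightarrow> 'a set" where
  "V_above A a = {p \<in> Spec A. a \<sqsubseteq>\<^bsub>A\<^esub> p}"

definition rho :: "('a, 'b) quantale_obj_scheme \<Rightarrow> 'a \<Rightarrow> 'a" where
  "rho A a = \<Sqinter>\<^bsub>A\<^esub> {p \<in> Spec A. a \<sqsubseteq>\<^bsub>A\<^esub> p}"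

text \<open>
  Both structures below keep the order of \<open>A\<close>, so that their joins are those of the restricted
  order; in \<open>radical_frame A\<close> these are \<open>rho A (\<Squnion>\<^bsub>A\<^esub> S)\<close>.
\<close>

definition radical_frame :: "('a, 'b) quantale_obj_scheme \<Rightarrow> ('a, 'b) quantale_obj_scheme" where
  "radical_frame A =
    A\<lparr>carrier := {a \<in> carrier A. rho A a = a}, qmult := (\<lambda>x y. x \<sqinter>\<^bsub>A\<^esub> y)\<rparr>"

definition up_quantale :: "('a, 'b) quantale_obj_scheme \<Rightarrow> 'a \<Rightarrow> ('a, 'b) quantale_obj_scheme" where
  "up_quantale A a =
    A\<lparr>carrier := {x \<in> carrier A. a \<sqsubseteq>\<^bsub>A\<^esub> x}, qmult := (\<lambda>x y. (x \<cdot>\<^bsub>A\<^esub> y) \<squnion>\<^bsub>A\<^esub> a)\<rparr>"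

definition Spec_flat :: "('a, 'b) quantale_obj_scheme \<Rightarrow> 'a topology" where
  "Spec_flat A = topology (arbitrary union_of (\<lambda>U. U \<in> V_above A ` compact_elements A))"

definition Min_flat :: "('a, 'b) quantale_obj_scheme \<Rightarrow> 'a topology" where
  "Min_flat A = subtopology (Spec_flat A) (Min_Spec A)"

text \<open>
  The function \<^const>\<open>topology\<close> is only meaningful on families of sets that do form a topology; the next
  lemmas show that this is the case here.
\<close>

context quantale
begin

lemma bottom_compact: "\<bottom> \<in> compact_elements A"
  unfolding compact_elements_def by (auto intro!: exI[of _ "{}"] bottom_lower sup_closed)

lemma join_compact:
  assumes c: "c \<in> compact_elements A" and d: "d \<in> compact_elements A"
  shows "c \<squnion> d \<in> compact_elements A"
proof -
  have cd: "c \<in> carrier A" "d \<in> carrier A"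
    using c d by (auto simp: compact_elements_def)
  have "\<exists>F\<subseteq>S. finite F \<and> c \<squnion> d \<sqsubseteq> \<Squnion> F" if S: "S \<subseteq> carrier A" and le: "c \<squnion> d \<sqsubseteq> \<Squnion> S" for S
  proof -
    have "c \<sqsubseteq> \<Squnion> S" "d \<sqsubseteq> \<Squnion> S"
      using le cd S by (meson join_closed join_left join_right le_trans sup_closed)+
    then obtain F G where FG: "F \<subseteq> S" "finite F" "c \<sqsubseteq> \<Squnion> F" "G \<subseteq> S" "finite G" "d \<sqsubseteq> \<Squnion> G"
      using c d S unfolding compact_elements_def by blast
    then have sub: "F \<subseteq> carrier A" "G \<subseteq> carrier A" "F \<union> G \<subseteq> carrier A"
      using S by auto
    have "\<Squnion> F \<sqsubseteq> \<Squnion> (F \<union> G)" "\<Squnion> G \<sqsubseteq> \<Squnion> (F \<union> G)"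
      using sub by (meson UnI1 UnI2 sup_closed sup_least sup_upper)+
    then have "c \<sqsubseteq> \<Squnion> (F \<union> G)" "d \<sqsubseteq> \<Squnion> (F \<union> G)"
      using FG sub cd by (meson le_trans sup_closed)+
    then have "c \<squnion> d \<sqsubseteq> \<Squnion> (F \<union> G)"
      using cd sub by (simp add: join_le)
    then show ?thesis
      using FG by (intro exI[of _ "F \<union> G"]) auto
  qed
  then show ?thesis
    using cd by (auto simp: compact_elements_def)
qed

lemma V_above_join:
  assumes "c \<in> carrier A" "d \<in> carrier A"
  shows "V_above A (c \<squnion> d) = V_above A c \<inter> V_above A d"
proof -
  have "c \<squnion> d \<sqsubseteq> p \<longleftrightarrow> c \<sqsubseteq> p \<and> d \<sqsubseteq> p" if "p \<in> Spec A" for p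
  proof -
    have "p \<in> carrier A" using that by (simp add: Spec_def m_prime_def)
    then show ?thesis
      using assms by (meson join_closed join_left join_right join_le le_trans)
  qed
  then show ?thesis by (auto simp: V_above_def)
qed

lemma openin_Spec_flat:
  "openin (Spec_flat A) U \<longleftrightarrow> (\<exists>C \<subseteq> compact_elements A. U = (\<Union>c\<in>C. V_above A c))"
proof -
  have "S \<inter> T \<in> V_above A ` compact_elements A"
    if "S \<in> V_above A ` compact_elements A" "T \<in> V_above A ` compact_elements A" for S T
  proof -
    from that obtain c d where cd: "c \<in> compact_elements A" "d \<in> compact_elements A"
      and ST: "S = V_above A c" "T = V_above A d" by blast
    then have "S \<inter> T = V_above A (c \<squnion> d)"
      by (simp add: V_above_join compact_elements_def)
    then show ?thesis using cd join_compact by blast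
  qed
  then have "istopology (arbitrary union_of (\<lambda>U. U \<in> V_above A ` compact_elements A))"
    by (intro istopology_base) auto
  then have "openin (Spec_flat A) = arbitrary union_of (\<lambda>U. U \<in> V_above A ` compact_elements A)"
    by (simp add: Spec_flat_def topology_inverse')
  then have "openin (Spec_flat A) U \<longleftrightarrow> (\<exists>\<U> \<subseteq> V_above A ` compact_elements A. \<Union>\<U> = U)"
    by (auto simp: union_of_def arbitrary_def)
  also have "\<dots> \<longleftrightarrow> (\<exists>C \<subseteq> compact_elements A. U = (\<Union>c\<in>C. V_above A c))"
    by (auto simp: subset_image_iff)
  finally show ?thesis .
qed

lemma topspace_Spec_flat: "topspace (Spec_flat A) = Spec A"
proof
  show "topspace (Spec_flat A) \<subseteq> Spec A"
    using openin_topspace[of "Spec_flat A"] unfolding openin_Spec_flat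
    by (force simp: V_above_def)
  have "V_above A \<bottom> = Spec A"
    by (auto simp: V_above_def Spec_def m_prime_def bottom_lower)
  then have "openin (Spec_flat A) (Spec A)"
    using bottom_compact by (auto simp: openin_Spec_flat intro!: exI[of _ "{\<bottom>}"])
  then show "Spec A \<subseteq> topspace (Spec_flat A)"
    by (rule openin_subset)
qed

end

end

(*
  Both R(A) and [rho(0)) have the same m-prime elements as A, ordered in the same way, so (3) and (4)
  only restate (1).  Flat open sets are up-sets of primes, which makes (5), (6) and (7) force two
  minimal primes below a common prime to coincide.

  Conversely, let every prime p lie above a unique minimal prime r(p).  Distinct minimal primes are
  comaximal, and since 1 is compact they have disjoint flat neighbourhoods; this gives (2) and (7).
  For continuity of r, let c be compact and below a minimal prime q, and let n be the meet of the
  minimal primes not above c.  A prime above both q and n would lie above a prime not above c, whose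
  minimal prime would have to be q; so q and n are comaximal, and some compact d <= q
  is comaximal with n.  Every prime above d then has its minimal prime above c.  Normality follows
  because Min_F(A), the image of the compact space Spec_F(A), is compact Hausdorff.
*)
theory Submission
  imports Defs
begin

section \<open>Elementary facts on order, multiplication and primes\<close>

lemma SpecD:
  assumes "p \<in> Spec A"
  shows "p \<in> carrier A" "p \<sqsubset>\<^bsub>A\<^esub> \<top>\<^bsub>A\<^esub>"
    "\<lbrakk>a \<in> carrier A; b \<in> carrier A; a \<cdot>\<^bsub>A\<^esub> b \<sqsubseteq>\<^bsub>A\<^esub> p\<rbrakk> \<Longrightarrow> a \<sqsubseteq>\<^bsub>A\<^esub> p \<or> b \<sqsubseteq>\<^bsub>A\<^esub> p"
  using assms by (auto simp: Spec_def m_prime_def)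

lemma Min_SpecD:
  assumes "p \<in> Min_Spec A" "q \<in> Spec A" "q \<sqsubseteq>\<^bsub>A\<^esub> p"
  shows "q = p"
  using assms by (simp add: Min_Spec_def)

lemma compact_elementsD:
  assumes "c \<in> compact_elements A" "S \<subseteq> carrier A" "c \<sqsubseteq>\<^bsub>A\<^esub> \<Squnion>\<^bsub>A\<^esub> S"
  obtains F where "F \<subseteq> S" "finite F" "c \<sqsubseteq>\<^bsub>A\<^esub> \<Squnion>\<^bsub>A\<^esub> F"
  using assms by (auto simp: compact_elements_def)

context quantale
begin

lemma Spec_carrier: "p \<in> Spec A \<Longrightarrow> p \<in> carrier A"
  by (rule SpecD)

lemma Min_Spec_imp_Spec: "p \<in> Min_Spec A \<Longrightarrow> p \<in> Spec A"
  by (simp add: Min_Spec_def)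

lemma Min_Spec_carrier: "p \<in> Min_Spec A \<Longrightarrow> p \<in> carrier A"
  by (intro Spec_carrier Min_Spec_imp_Spec)

lemma compact_elements_carrier: "c \<in> compact_elements A \<Longrightarrow> c \<in> carrier A"
  by (simp add: compact_elements_def)

lemma le_antisym: "\<lbrakk>x \<sqsubseteq> y; y \<sqsubseteq> x; x \<in> carrier A; y \<in> carrier A\<rbrakk> \<Longrightarrow> x = y"
  using weak_le_antisym by (simp add: eq_is_equal)

lemma join_le_iff:
  assumes "x \<in> carrier A" "y \<in> carrier A" "z \<in> carrier A"
  shows "x \<squnion> y \<sqsubseteq> z \<longleftrightarrow> x \<sqsubseteq> z \<and> y \<sqsubseteq> z"
  using assms by (meson join_closed join_le join_left join_right le_trans)

lemma top_not_le_Spec: "p \<in> Spec A \<Longrightarrow> \<not> \<top> \<sqsubseteq> p"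
  by (metis Spec_carrier SpecD(2) lless_def eq_is_equal le_antisym top_closed)

lemma SpecI:
  assumes "p \<in> carrier A" "\<not> \<top> \<sqsubseteq> p"
    and "\<And>a b. \<lbrakk>a \<in> carrier A; b \<in> carrier A; a \<cdot> b \<sqsubseteq> p\<rbrakk> \<Longrightarrow> a \<sqsubseteq> p \<or> b \<sqsubseteq> p"
  shows "p \<in> Spec A"
  using assms unfolding Spec_def m_prime_def lless_def
  by (auto simp: eq_is_equal)

lemma qmult_join:
  assumes "x \<in> carrier A" "y \<in> carrier A" "z \<in> carrier A"
  shows "x \<cdot> (y \<squnion> z) = x \<cdot> y \<squnion> x \<cdot> z"
  using qmult_sup_distrib[of x "{y, z}"] assms by (simp add: join_def)

lemma qmult_mono:
  assumes "x \<in> carrier A" "y \<in> carrier A" "z \<in> carrier A" "y \<sqsubseteq> z"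
  shows "x \<cdot> y \<sqsubseteq> x \<cdot> z"
proof -
  have "y \<squnion> z = z"
    using assms by (meson join_closed join_le join_right le_antisym le_refl)
  then have "x \<cdot> z = x \<cdot> y \<squnion> x \<cdot> z"
    using qmult_join[of x y z] assms by simp
  then show ?thesis
    using assms join_left[of "x \<cdot> y" "x \<cdot> z"] by simp
qed

text \<open>Multiplication is monotone and its unit is the top element, so multiplying can only
  lower.\<close>

lemma qmult_le_left: "\<lbrakk>x \<in> carrier A; y \<in> carrier A\<rbrakk> \<Longrightarrow> x \<cdot> y \<sqsubseteq> x"
  using qmult_mono[of x y \<top>] by (simp add: qmult_top)

lemma qmult_le_right: "\<lbrakk>x \<in> carrier A; y \<in> carrier A\<rbrakk> \<Longrightarrow> x \<cdot> y \<sqsubseteq> y"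
  using qmult_le_left[of y x] by (simp add: qmult_comm)

text \<open>After expanding, every term except \<open>b \<cdot> a\<close> has a factor
  \<open>p\<close>. This lets \<open>p \<squnion> a\<close> stand in for \<open>a\<close> when
  primeness is tested, both for maximal elements and in the up-sets \<open>[a)\<close>.\<close>

lemma qmult_join_join_le:
  assumes "p \<in> carrier A" "a \<in> carrier A" "b \<in> carrier A"
  shows "(p \<squnion> a) \<cdot> (p \<squnion> b) \<sqsubseteq> p \<squnion> a \<cdot> b"
proof -
  have "(p \<squnion> a) \<cdot> (p \<squnion> b) = (p \<squnion> a) \<cdot> p \<squnion> (b \<cdot> p \<squnion> b \<cdot> a)"
    using assms by (simp add: qmult_join qmult_comm[of "p \<squnion> a" b])
  moreover have "(p \<squnion> a) \<cdot> p \<sqsubseteq> p \<squnion> a \<cdot> b" "b \<cdot> p \<sqsubseteq> p \<squnion> a \<cdot> b"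
    using assms by (meson join_closed join_left le_trans qmult_closed qmult_le_right)+
  moreover have "b \<cdot> a \<sqsubseteq> p \<squnion> a \<cdot> b"
    using assms by (simp add: qmult_comm[of b a] join_right)
  ultimately show ?thesis
    using assms by (simp add: join_le_iff)
qed

section \<open>Zorn's lemma on the carrier and minimal primes\<close>

text \<open>The order is only reflexive and antisymmetric on the carrier, so Zorn is applied to its
  restriction to \<open>X\<close>. The chain condition includes the empty chain, which makes
  \<open>X\<close> nonempty.\<close>

lemma exists_maximal:
  assumes X: "X \<subseteq> carrier A"
    and chain: "\<And>C. \<lbrakk>C \<subseteq> X; \<And>x y. \<lbrakk>x \<in> C; y \<in> C\<rbrakk> \<Longrightarrow> x \<sqsubseteq> y \<or> y \<sqsubseteq> x\<rbrakk> \<Longrightarrow> \<exists>u\<in>X. \<forall>x\<in>C. x \<sqsubseteq> u"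
  shows "\<exists>m\<in>X. \<forall>x\<in>X. m \<sqsubseteq> x \<longrightarrow> x = m"
proof (rule predicate_Zorn)
  show "partial_order_on X (relation_of (\<sqsubseteq>) X)"
    using X by (intro partial_order_on_relation_ofI) (auto intro: le_trans le_antisym)
  show "\<exists>u\<in>X. \<forall>x\<in>C. x \<sqsubseteq> u" if "C \<in> Chains (relation_of (\<sqsubseteq>) X)" for C
    using that by (intro chain) (auto simp: Chains_def relation_of_def)
qed

lemma exists_minimal:
  assumes X: "X \<subseteq> carrier A"
    and chain: "\<And>C. \<lbrakk>C \<subseteq> X; \<And>x y. \<lbrakk>x \<in> C; y \<in> C\<rbrakk> \<Longrightarrow> x \<sqsubseteq> y \<or> y \<sqsubseteq> x\<rbrakk> \<Longrightarrow> \<exists>u\<in>X. \<forall>x\<in>C. u \<sqsubseteq> x"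
  shows "\<exists>m\<in>X. \<forall>x\<in>X. x \<sqsubseteq> m \<longrightarrow> x = m"
proof (rule predicate_Zorn)
  show "partial_order_on X (relation_of (\<lambda>x y. y \<sqsubseteq> x) X)"
    using X by (intro partial_order_on_relation_ofI) (auto intro: le_trans le_antisym)
  show "\<exists>u\<in>X. \<forall>x\<in>C. u \<sqsubseteq> x" if "C \<in> Chains (relation_of (\<lambda>x y. y \<sqsubseteq> x) X)" for C
    using that by (intro chain) (auto simp: Chains_def relation_of_def)
qed

text \<open>If \<open>b\<close> is not below the meet, it is not below some \<open>q\<close> in the
  chain. Members below \<open>q\<close> are not above \<open>b\<close> either, so by primeness they
  are above \<open>a\<close>; members above \<open>q\<close> inherit \<open>a\<close> from
  \<open>q\<close>.\<close>

lemma Inf_chain_Spec: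
  assumes C: "C \<subseteq> Spec A" "C \<noteq> {}"
    and chain: "\<And>x y. \<lbrakk>x \<in> C; y \<in> C\<rbrakk> \<Longrightarrow> x \<sqsubseteq> y \<or> y \<sqsubseteq> x"
  shows "\<Sqinter> C \<in> Spec A"
proof (rule SpecI)
  have sub: "C \<subseteq> carrier A"
    using C Spec_carrier by blast
  then show "\<Sqinter> C \<in> carrier A"
    by simp
  obtain q where q: "q \<in> C"
    using C(2) by blast
  then have "\<Sqinter> C \<sqsubseteq> q" "\<not> \<top> \<sqsubseteq> q"
    using inf_lower[OF sub q] top_not_le_Spec C(1) by auto
  then show "\<not> \<top> \<sqsubseteq> \<Sqinter> C"
    using le_trans[of \<top> "\<Sqinter> C" q] sub q by auto
  fix a b assume ab: "a \<in> carrier A" "b \<in> carrier A" "a \<cdot> b \<sqsubseteq> \<Sqinter> C"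
  have "a \<sqsubseteq> \<Sqinter> C" if nb: "\<not> b \<sqsubseteq> \<Sqinter> C"
  proof -
    obtain q where q: "q \<in> C" "\<not> b \<sqsubseteq> q"
      using inf_greatest[OF sub ab(2)] nb by blast
    have below: "a \<cdot> b \<sqsubseteq> x" if "x \<in> C" for x
      using that ab sub by (meson inf_closed inf_lower le_trans qmult_closed subsetD)
    have "a \<sqsubseteq> x" if x: "x \<in> C" for x
    proof (cases "x \<sqsubseteq> q")
      case True
      then have "\<not> b \<sqsubseteq> x"
        using q x sub ab by (meson le_trans subsetD)
      then show ?thesis
        using SpecD(3)[OF subsetD[OF C(1) x] ab(1,2) below[OF x]] by blast
    next
      case False
      then have "q \<sqsubseteq> x" using chain q x by blast
      moreover have "a \<sqsubseteq> q"
        using SpecD(3)[OF subsetD[OF C(1) q(1)] ab(1,2) below[OF q(1)]] q by blast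
      ultimately show ?thesis
        using q x sub ab by (meson le_trans subsetD)
    qed
    then show ?thesis
      using inf_greatest[OF sub ab(1)] by blast
  qed
  then show "a \<sqsubseteq> \<Sqinter> C \<or> b \<sqsubseteq> \<Sqinter> C"
    by blast
qed

text \<open>Zorn downwards among the primes below \<open>p\<close>: meets of nonempty chains of
  primes are prime, and \<open>p\<close> itself bounds the empty chain.\<close>

lemma Min_Spec_below:
  assumes p: "p \<in> Spec A"
  shows "\<exists>q\<in>Min_Spec A. q \<sqsubseteq> p"
proof -
  let ?X = "{q \<in> Spec A. q \<sqsubseteq> p}"
  have "\<exists>m\<in>?X. \<forall>x\<in>?X. x \<sqsubseteq> m \<longrightarrow> x = m"
  proof (rule exists_minimal)
    show "?X \<subseteq> carrier A"
      by (auto intro: Spec_carrier)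
    fix C assume C: "C \<subseteq> ?X" "\<And>x y. \<lbrakk>x \<in> C; y \<in> C\<rbrakk> \<Longrightarrow> x \<sqsubseteq> y \<or> y \<sqsubseteq> x"
    then have sub: "C \<subseteq> carrier A" "C \<subseteq> Spec A"
      by (auto intro: Spec_carrier)
    show "\<exists>u\<in>?X. \<forall>x\<in>C. u \<sqsubseteq> x"
    proof (cases "C = {}")
      case True
      then show ?thesis using p by (auto intro: Spec_carrier)
    next
      case False
      then have "\<Sqinter> C \<in> Spec A"
        using Inf_chain_Spec[OF sub(2)] C by blast
      moreover obtain q where "q \<in> C"
        using False by blast
      moreover from this have "\<Sqinter> C \<sqsubseteq> p"
        using C(1) subsetD[OF sub(1), of q] inf_closed[OF sub(1)] Spec_carrier[OF p]
          inf_lower[OF sub(1), of q] le_trans[of "\<Sqinter> C" q p]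
        by blast
      ultimately show ?thesis
        using sub inf_lower by blast
    qed
  qed
  then obtain m where m: "m \<in> Spec A" "m \<sqsubseteq> p" "\<And>x. \<lbrakk>x \<in> Spec A; x \<sqsubseteq> p; x \<sqsubseteq> m\<rbrakk> \<Longrightarrow> x = m"
    by blast
  then have "m \<in> Min_Spec A"
    using p le_trans[of _ m p] Spec_carrier by (auto simp: Min_Spec_def)
  then show ?thesis
    using m by blast
qed

section \<open>Flat open and closed sets\<close>

lemma V_above_le:
  assumes "q \<in> V_above A c" "q \<sqsubseteq> p" "p \<in> Spec A" "c \<in> carrier A"
  shows "p \<in> V_above A c"
  using assms by (auto simp: V_above_def intro: le_trans Spec_carrier)

text \<open>The sets \<open>V_above A c\<close> form a base, and \<open>p\<close> lies in such a set
  exactly when \<open>c\<close> is below \<open>p\<close>. Later proofs use this pointwise form to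
  show that a set is open.\<close>

lemma openin_Spec_flat_iff:
  "openin (Spec_flat A) U \<longleftrightarrow>
    U \<subseteq> Spec A \<and> (\<forall>p\<in>U. \<exists>c\<in>compact_elements A. c \<sqsubseteq> p \<and> V_above A c \<subseteq> U)" (is "?L \<longleftrightarrow> ?R")
proof
  show ?R if ?L
    using that unfolding openin_Spec_flat by (fastforce simp: V_above_def)
  assume R: ?R
  show ?L
    unfolding openin_Spec_flat
  proof (intro exI conjI)
    show "U = (\<Union>c\<in>{c \<in> compact_elements A. V_above A c \<subseteq> U}. V_above A c)"
      using R by (fastforce simp: V_above_def)
  qed blast
qed

lemma openin_V_above: "c \<in> compact_elements A \<Longrightarrow> openin (Spec_flat A) (V_above A c)"
  unfolding openin_Spec_flat by (intro exI[of _ "{c}"]) auto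

text \<open>A basic open set consists of all primes above one compact element, so it contains every
  prime above one of its members. This is what forces minimal primes below a common prime to
  coincide.\<close>

lemma openin_Spec_flat_up:
  assumes "openin (Spec_flat A) U" "q \<in> U" "q \<sqsubseteq> p" "p \<in> Spec A"
  shows "p \<in> U"
proof -
  obtain c where c: "c \<in> compact_elements A" "c \<sqsubseteq> q" "V_above A c \<subseteq> U" and q: "q \<in> Spec A"
    using assms(1,2) unfolding openin_Spec_flat_iff by blast
  then have "q \<in> V_above A c"
    by (simp add: V_above_def)
  then have "p \<in> V_above A c"
    using V_above_le assms(3,4) compact_elements_carrier[OF c(1)] by blast
  then show ?thesis using c by blast
qed

lemma closedin_Spec_flat_down:
  assumes "closedin (Spec_flat A) U" "p \<in> U" "q \<sqsubseteq> p" "q \<in> Spec A"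
  shows "q \<in> U"
  using assms openin_Spec_flat_up[of "Spec A - U" q p]
  by (auto simp: closedin_def topspace_Spec_flat)

end

section \<open>Compact elements, existence of primes, and compactness of the flat spectrum\<close>

context coherent_quantale
begin

lemma compact_le_imp_le:
  assumes "a \<in> carrier A" "b \<in> carrier A"
    and "\<And>c. \<lbrakk>c \<in> compact_elements A; c \<sqsubseteq> a\<rbrakk> \<Longrightarrow> c \<sqsubseteq> b"
  shows "a \<sqsubseteq> b"
proof -
  obtain S where S: "S \<subseteq> compact_elements A" "a = \<Squnion> S"
    using join_of_compact assms by blast
  then have Sc: "S \<subseteq> carrier A"
    using compact_elements_carrier by blast
  then have "x \<sqsubseteq> b" if "x \<in> S" for x
    using assms(3)[OF subsetD[OF S(1) that]] sup_upper[OF _ that] S(2) Sc by simp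
  then show ?thesis
    unfolding S(2) using assms(2) Sc by (intro sup_least) auto
qed

lemma finite_sup_compact:
  assumes "finite F" "F \<subseteq> compact_elements A"
  shows "\<Squnion> F \<in> compact_elements A"
  using assms
proof (induction F rule: finite_induct)
  case empty
  have "\<Squnion> {} = \<bottom>"
    using weak_sup_empty by (simp add: eq_is_equal)
  then show ?case by (simp add: bottom_compact)
next
  case (insert x F)
  then have "\<Squnion> (insert x F) = x \<squnion> \<Squnion> F"
    using weak_sup_insert[of x F] compact_elements_carrier by (auto simp: eq_is_equal subset_iff)
  then show ?case
    using insert by (simp add: join_compact)
qed

text \<open>Krull-type separation: an element maximal among those above \<open>a\<close> that are
  above no member of \<open>S\<close> is prime. Later existence proofs for primes choose
  \<open>S\<close> to suit their purpose.\<close>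

lemma prime_avoiding:
  assumes S: "S \<subseteq> compact_elements A" "\<top> \<in> S"
    and mult: "\<And>s t. \<lbrakk>s \<in> S; t \<in> S\<rbrakk> \<Longrightarrow> s \<cdot> t \<in> S"
    and a: "a \<in> carrier A" "\<And>s. s \<in> S \<Longrightarrow> \<not> s \<sqsubseteq> a"
  shows "\<exists>p\<in>Spec A. a \<sqsubseteq> p \<and> (\<forall>s\<in>S. \<not> s \<sqsubseteq> p)"
proof -
  have Sc: "s \<in> carrier A" if "s \<in> S" for s
    using that S compact_elements_carrier by blast
  let ?X = "{x \<in> carrier A. a \<sqsubseteq> x \<and> (\<forall>s\<in>S. \<not> s \<sqsubseteq> x)}"
  have "\<exists>m\<in>?X. \<forall>x\<in>?X. m \<sqsubseteq> x \<longrightarrow> x = m"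
  proof (rule exists_maximal)
    show "?X \<subseteq> carrier A" by blast
    fix C assume C: "C \<subseteq> ?X" and chain: "\<And>x y. \<lbrakk>x \<in> C; y \<in> C\<rbrakk> \<Longrightarrow> x \<sqsubseteq> y \<or> y \<sqsubseteq> x"
    have sub: "C \<subseteq> carrier A"
      using C by blast
    show "\<exists>u\<in>?X. \<forall>x\<in>C. x \<sqsubseteq> u"
    proof (cases "C = {}")
      case True
      then show ?thesis using a by auto
    next
      case False
      \<comment> \<open>Compactness of \<open>s\<close> leaves only a finite part \<open>F\<close>
        of the chain. A single member of \<open>C\<close> bounds \<open>F\<close>, and that member
        would then be above \<open>s\<close>.\<close>
      have "\<not> s \<sqsubseteq> \<Squnion> C" if s: "s \<in> S" for s
      proof
        assume "s \<sqsubseteq> \<Squnion> C"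
        then obtain F where F: "F \<subseteq> C" "finite F" "s \<sqsubseteq> \<Squnion> F"
          using compact_elementsD[of s A C] S(1) s sub by blast
        have "\<exists>u\<in>C. \<forall>x\<in>F. x \<sqsubseteq> u"
          using F(2,1)
        proof (induction F rule: finite_induct)
          case empty
          then show ?case using False by blast
        next
          case (insert x F)
          then obtain u where u: "u \<in> C" "\<forall>x\<in>F. x \<sqsubseteq> u" "x \<in> C" "F \<subseteq> C"
            by auto
          show ?case
          proof (cases "x \<sqsubseteq> u")
            case True
            then show ?thesis using u by blast
          next
            case False
            then have "u \<sqsubseteq> x" using chain u by blast
            then have "y \<sqsubseteq> x" if "y \<in> F" for y
              using that u le_trans[of y u x] \<open>u \<sqsubseteq> x\<close> subsetD[OF sub] by blast
            moreover have "x \<sqsubseteq> x"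
              using u sub by auto
            ultimately have "\<forall>y\<in>insert x F. y \<sqsubseteq> x"
              by blast
            then show ?thesis using u by blast
          qed
        qed
        then obtain u where u: "u \<in> C" "\<forall>x\<in>F. x \<sqsubseteq> u"
          by blast
        then have "\<Squnion> F \<sqsubseteq> u"
          using F sub by (intro sup_least) auto
        then have "s \<sqsubseteq> u"
          using F u sub Sc[OF s] le_trans[of s "\<Squnion> F" u] by auto
        then show False
          using C u s by blast
      qed
      moreover have "a \<sqsubseteq> \<Squnion> C"
      proof -
        obtain x where "x \<in> C"
          using False by blast
        then show ?thesis
          using C sub a sup_upper[OF sub, of x] le_trans[of a x "\<Squnion> C"] by auto
      qed
      ultimately show ?thesis
        using sub sup_upper[OF sub] by (intro bexI[of _ "\<Squnion> C"]) auto
    qed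
  qed
  then obtain m where m: "m \<in> carrier A" "a \<sqsubseteq> m" "\<And>s. s \<in> S \<Longrightarrow> \<not> s \<sqsubseteq> m"
    and max: "\<And>x. \<lbrakk>x \<in> carrier A; a \<sqsubseteq> x; \<forall>s\<in>S. \<not> s \<sqsubseteq> x; m \<sqsubseteq> x\<rbrakk> \<Longrightarrow> x = m"
    by blast
  \<comment> \<open>By maximality, enlarging \<open>m\<close> properly loses the avoidance of
    \<open>S\<close>.\<close>
  have ex: "\<exists>s\<in>S. s \<sqsubseteq> m \<squnion> x" if x: "x \<in> carrier A" "\<not> x \<sqsubseteq> m" for x
  proof (rule ccontr)
    assume "\<not> ?thesis"
    moreover have "a \<sqsubseteq> m \<squnion> x"
      using m x a join_left[of m x] le_trans[of a m "m \<squnion> x"] by simp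
    ultimately have "m \<squnion> x = m"
      using m x by (intro max) (auto simp: join_left)
    then show False
      using m x join_right by metis
  qed
  have "m \<in> Spec A"
  proof (rule SpecI)
    show "m \<in> carrier A" "\<not> \<top> \<sqsubseteq> m"
      using m S by auto
    fix x y assume xy: "x \<in> carrier A" "y \<in> carrier A" "x \<cdot> y \<sqsubseteq> m"
    show "x \<sqsubseteq> m \<or> y \<sqsubseteq> m"
    proof (rule ccontr)
      assume "\<not> ?thesis"
      then obtain s t where st: "s \<in> S" "t \<in> S" "s \<sqsubseteq> m \<squnion> x" "t \<sqsubseteq> m \<squnion> y"
        using ex[OF xy(1)] ex[OF xy(2)] by metis
      have stc: "s \<in> carrier A" "t \<in> carrier A"
        using st Sc by auto
      \<comment> \<open>The product \<open>s \<cdot> t\<close> is pushed below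
        \<open>m \<squnion> x \<cdot> y\<close>, hence below \<open>m\<close>, although it belongs
        to the multiplicative set \<open>S\<close>.\<close>
      have "s \<cdot> t \<sqsubseteq> s \<cdot> (m \<squnion> y)"
        using st stc m xy by (intro qmult_mono) auto
      moreover have "s \<cdot> (m \<squnion> y) \<sqsubseteq> (m \<squnion> x) \<cdot> (m \<squnion> y)"
        using st stc m xy qmult_mono[of "m \<squnion> y" s "m \<squnion> x"]
        by (simp add: qmult_comm[of _ "m \<squnion> y"])
      moreover have "(m \<squnion> x) \<cdot> (m \<squnion> y) \<sqsubseteq> m \<squnion> x \<cdot> y"
        using m xy by (intro qmult_join_join_le) auto
      moreover have "m \<squnion> x \<cdot> y \<sqsubseteq> m"
        using m xy by (simp add: join_le_iff)
      ultimately have "s \<cdot> t \<sqsubseteq> m"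
        using m xy stc by (blast intro: le_trans join_closed qmult_closed)
      then show False
        using m mult st by blast
    qed
  qed
  then show ?thesis
    using m by blast
qed

text \<open>The multiplicative set to avoid is just \<open>{\<top>}\<close>.\<close>

lemma prime_above:
  assumes "a \<in> carrier A" "a \<noteq> \<top>"
  shows "\<exists>p\<in>Spec A. a \<sqsubseteq> p"
proof -
  have "\<not> \<top> \<sqsubseteq> a"
    using assms by (metis le_antisym top_closed top_higher)
  then show ?thesis
    using assms top_compact prime_avoiding[of "{\<top>}" a] by (auto simp: qmult_top)
qed

text \<open>Write \<open>a\<close> as a join of compact elements. The top is compact, so finitely
  many of them together with \<open>b\<close> already reach it. This turns comaximality into a
  statement about flat neighbourhoods.\<close>

lemma rel_prime_compact:
  assumes ab: "a \<in> carrier A" "b \<in> carrier A" "a \<squnion> b = \<top>"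
  obtains d where "d \<in> compact_elements A" "d \<sqsubseteq> a" "d \<squnion> b = \<top>"
proof -
  obtain S where S: "S \<subseteq> compact_elements A" "a = \<Squnion> S"
    using join_of_compact ab by blast
  then have sub: "S \<subseteq> carrier A" "insert b S \<subseteq> carrier A"
    using ab compact_elements_carrier by blast+
  have "a \<squnion> b \<sqsubseteq> \<Squnion> (insert b S)"
    using sub ab unfolding S(2) by (intro join_le sup_least sup_upper sup_closed) auto
  then obtain F where F: "F \<subseteq> insert b S" "finite F" "\<top> \<sqsubseteq> \<Squnion> F"
    using compact_elementsD[OF top_compact sub(2)] ab by metis
  \<comment> \<open>Removing \<open>b\<close>, which need not be compact, leaves members of
    \<open>S\<close> only, so \<open>?d\<close> is compact and below \<open>a\<close>.\<close>
  let ?d = "\<Squnion> (F - {b})"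
  have Fb: "F - {b} \<subseteq> S" "F - {b} \<subseteq> carrier A" "F \<subseteq> carrier A"
    using F(1) sub by auto
  have d: "?d \<in> compact_elements A"
    using F(2) Fb(1) S(1) by (intro finite_sup_compact) auto
  have "?d \<sqsubseteq> a"
    unfolding S(2) using Fb sub by (intro sup_least sup_upper sup_closed) auto
  moreover have "x \<sqsubseteq> ?d \<squnion> b" if x: "x \<in> F" for x
  proof (cases "x = b")
    case True
    then show ?thesis using ab Fb by (simp add: join_right)
  next
    case False
    then have "x \<sqsubseteq> ?d" using x Fb(2) by (intro sup_upper) auto
    then show ?thesis
      using ab Fb x join_left[of ?d b] le_trans[of x ?d "?d \<squnion> b"] by auto
  qed
  then have "\<Squnion> F \<sqsubseteq> ?d \<squnion> b"
    using Fb ab by (intro sup_least) auto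
  then have "?d \<squnion> b = \<top>"
    using F(3) Fb ab le_trans[of \<top> "\<Squnion> F" "?d \<squnion> b"] by (auto intro!: le_antisym)
  ultimately show thesis
    using that d by blast
qed

text \<open>In the topology whose basic open sets consist of the primes not above a given compact
  \<open>s\<close>, the hypothesis puts \<open>r\<close> in the closure of the primes not above
  \<open>c\<close>. The conclusion makes \<open>r\<close> a specialisation of one of these
  primes.\<close>

lemma exists_prime_below_not_above:
  assumes r: "r \<in> Spec A" and c: "c \<in> compact_elements A"
    and ex: "\<And>s. \<lbrakk>s \<in> compact_elements A; \<not> s \<sqsubseteq> r\<rbrakk> \<Longrightarrow> \<exists>p\<in>Spec A. \<not> c \<sqsubseteq> p \<and> \<not> s \<sqsubseteq> p"
  shows "\<exists>p\<in>Spec A. p \<sqsubseteq> r \<and> \<not> c \<sqsubseteq> p"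
proof -
  \<comment> \<open>This set contains \<open>c\<close> (take \<open>s\<close> to be the top) and
    every compact element not below \<open>r\<close> (take it as its own \<open>s\<close>). A prime
    avoiding it is therefore not above \<open>c\<close>, and all compact elements below it are below
    \<open>r\<close>.\<close>
  define S where "S = {x \<in> compact_elements A. \<exists>s\<in>compact_elements A. \<not> s \<sqsubseteq> r \<and>
    (\<forall>p\<in>Spec A. x \<sqsubseteq> p \<longrightarrow> c \<sqsubseteq> p \<or> s \<sqsubseteq> p)}"
  have K: "S \<subseteq> compact_elements A"
    by (auto simp: S_def)
  have cS: "c \<in> S"
    using c top_compact top_not_le_Spec[OF r] by (auto simp: S_def)
  have sS: "s \<in> S" if "s \<in> compact_elements A" "\<not> s \<sqsubseteq> r" for s
    using that by (auto simp: S_def)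
  have top: "\<top> \<in> S"
    using sS top_compact top_not_le_Spec[OF r] by blast
  have mult: "x \<cdot> y \<in> S" if xy: "x \<in> S" "y \<in> S" for x y
  proof -
    obtain s where s: "s \<in> compact_elements A" "\<not> s \<sqsubseteq> r" "\<And>p. \<lbrakk>p \<in> Spec A; x \<sqsubseteq> p\<rbrakk> \<Longrightarrow> c \<sqsubseteq> p \<or> s \<sqsubseteq> p"
      using xy(1) by (auto simp: S_def)
    obtain t where t: "t \<in> compact_elements A" "\<not> t \<sqsubseteq> r" "\<And>p. \<lbrakk>p \<in> Spec A; y \<sqsubseteq> p\<rbrakk> \<Longrightarrow> c \<sqsubseteq> p \<or> t \<sqsubseteq> p"
      using xy(2) by (auto simp: S_def)
    have car: "x \<in> carrier A" "y \<in> carrier A" "s \<in> carrier A" "t \<in> carrier A"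
      using xy s(1) t(1) K compact_elements_carrier by auto
    \<comment> \<open>The witness for \<open>x \<cdot> y\<close> is the product of the two
      witnesses; primeness of \<open>r\<close> keeps it from being below \<open>r\<close>.\<close>
    have "\<not> s \<cdot> t \<sqsubseteq> r"
      using SpecD(3)[OF r car(3,4)] s(2) t(2) by blast
    moreover have "c \<sqsubseteq> p \<or> s \<cdot> t \<sqsubseteq> p" if p: "p \<in> Spec A" "x \<cdot> y \<sqsubseteq> p" for p
    proof -
      have "s \<cdot> t \<sqsubseteq> p" if "s \<sqsubseteq> p \<or> t \<sqsubseteq> p"
        using that car Spec_carrier[OF p(1)] qmult_le_left[OF car(3,4)] qmult_le_right[OF car(3,4)]
          le_trans[of "s \<cdot> t" s p] le_trans[of "s \<cdot> t" t p] by auto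
      then show ?thesis
        using SpecD(3)[OF p(1) car(1,2) p(2)] s(3)[OF p(1)] t(3)[OF p(1)] by blast
    qed
    moreover have "s \<cdot> t \<in> compact_elements A" "x \<cdot> y \<in> compact_elements A"
      using s(1) t(1) xy K compact_qmult by blast+
    ultimately show ?thesis
      unfolding S_def by blast
  qed
  \<comment> \<open>Such an \<open>x\<close> would lie below every prime, in particular below the
    one that \<open>ex\<close> supplies for its witness \<open>s\<close>, which is above neither
    \<open>c\<close> nor \<open>s\<close>.\<close>
  have "\<not> x \<sqsubseteq> \<bottom>" if x: "x \<in> S" for x
  proof
    assume le: "x \<sqsubseteq> \<bottom>"
    obtain s where s: "s \<in> compact_elements A" "\<not> s \<sqsubseteq> r" "\<And>p. \<lbrakk>p \<in> Spec A; x \<sqsubseteq> p\<rbrakk> \<Longrightarrow> c \<sqsubseteq> p \<or> s \<sqsubseteq> p"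
      using x by (auto simp: S_def)
    obtain p where p: "p \<in> Spec A" "\<not> c \<sqsubseteq> p" "\<not> s \<sqsubseteq> p"
      using ex[OF s(1,2)] by blast
    have "x \<in> carrier A"
      using x K compact_elements_carrier by blast
    then have "x \<sqsubseteq> p"
      using le bottom_lower le_trans[of x \<bottom> p] Spec_carrier[OF p(1)] by auto
    then show False using s(3) p by blast
  qed
  then obtain p where p: "p \<in> Spec A" "\<And>s. s \<in> S \<Longrightarrow> \<not> s \<sqsubseteq> p"
    using prime_avoiding[OF K top mult, of \<bottom>] by (metis bottom_closed)
  have "p \<sqsubseteq> r"
  proof (rule compact_le_imp_le)
    show "p \<in> carrier A" "r \<in> carrier A"
      using p(1) r by (auto intro: Spec_carrier)
    show "c' \<sqsubseteq> r" if "c' \<in> compact_elements A" "c' \<sqsubseteq> p" for c'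
      using sS[OF that(1)] p(2) that(2) by blast
  qed
  then show ?thesis
    using p cS by blast
qed

text \<open>Let \<open>S\<close> consist of the compact \<open>x\<close> for which finitely many
  cover members suffice for \<open>V_above A x\<close>. It is multiplicative, and without a finite
  subcover it has no member below the bottom. A prime avoiding \<open>S\<close> lies in some cover
  member, which contains a basic neighbourhood \<open>V_above A c\<close> of it; then
  \<open>c\<close> is in \<open>S\<close> and below the prime.\<close>

lemma compact_space_Spec_flat: "compact_space (Spec_flat A)"
  unfolding compact_space_alt topspace_Spec_flat
proof (intro allI impI, elim conjE)
  fix \<U> assume op: "\<forall>U\<in>\<U>. openin (Spec_flat A) U" and cov: "Spec A \<subseteq> \<Union>\<U>"
  define S where "S = {x \<in> compact_elements A. \<exists>\<F>. finite \<F> \<and> \<F> \<subseteq> \<U> \<and> V_above A x \<subseteq> \<Union>\<F>}"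
  show "\<exists>\<F>. finite \<F> \<and> \<F> \<subseteq> \<U> \<and> Spec A \<subseteq> \<Union>\<F>"
  proof (rule ccontr)
    assume neg: "\<not> ?thesis"
    have K: "S \<subseteq> compact_elements A"
      by (auto simp: S_def)
    have "V_above A \<top> = {}"
      using top_not_le_Spec by (auto simp: V_above_def)
    then have top: "\<top> \<in> S"
      using top_compact by (auto simp: S_def)
    have mult: "x \<cdot> y \<in> S" if xy: "x \<in> S" "y \<in> S" for x y
    proof -
      obtain \<F> \<G> where FG: "finite \<F>" "\<F> \<subseteq> \<U>" "V_above A x \<subseteq> \<Union>\<F>" "finite \<G>" "\<G> \<subseteq> \<U>" "V_above A y \<subseteq> \<Union>\<G>"
        using xy by (auto simp: S_def)
      have car: "x \<in> carrier A" "y \<in> carrier A"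
        using xy K compact_elements_carrier by auto
      have "V_above A (x \<cdot> y) \<subseteq> V_above A x \<union> V_above A y"
        using SpecD(3)[OF _ car] by (auto simp: V_above_def)
      then have "V_above A (x \<cdot> y) \<subseteq> \<Union>(\<F> \<union> \<G>)"
        using FG by blast
      then show ?thesis
        using FG xy K compact_qmult[of x y] unfolding S_def
        by (intro CollectI conjI exI[of _ "\<F> \<union> \<G>"]) auto
    qed
    have "\<not> x \<sqsubseteq> \<bottom>" if x: "x \<in> S" for x
    proof
      assume le: "x \<sqsubseteq> \<bottom>"
      have "x \<in> carrier A"
        using x K compact_elements_carrier by blast
      then have "Spec A \<subseteq> V_above A x"
        using le bottom_lower le_trans[of x \<bottom>] Spec_carrier by (auto simp: V_above_def)
      then show False
        using x neg unfolding S_def by blast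
    qed
    then obtain p where p: "p \<in> Spec A" "\<And>s. s \<in> S \<Longrightarrow> \<not> s \<sqsubseteq> p"
      using prime_avoiding[OF K top mult, of \<bottom>] by (metis bottom_closed)
    then obtain U where U: "U \<in> \<U>" "p \<in> U"
      using cov by blast
    then obtain c where c: "c \<in> compact_elements A" "c \<sqsubseteq> p" "V_above A c \<subseteq> U"
      using op openin_Spec_flat_iff[of U] by blast
    then have "c \<in> S"
      using U unfolding S_def by (intro CollectI conjI exI[of _ "{U}"]) auto
    then show False
      using p c by blast
  qed
qed

section \<open>Reformulations of the mp condition and the flat retraction\<close>

text \<open>A minimal prime below a given prime exists by \<open>Min_Spec_below\<close>, so only
  uniqueness is at stake.\<close>

lemma mp_quantale_iff:
  "mp_quantale A \<longleftrightarrow> (\<forall>p\<in>Spec A. \<forall>q\<in>Min_Spec A. \<forall>q'\<in>Min_Spec A. q \<sqsubseteq> p \<longrightarrow> q' \<sqsubseteq> p \<longrightarrow> q = q')"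
    (is "_ \<longleftrightarrow> ?R")
proof
  show ?R if "mp_quantale A"
    using mp_quantale.unique_minimal[OF that] by blast
  assume R: ?R
  show "mp_quantale A"
  proof (intro mp_quantale.intro mp_quantale_axioms.intro)
    show "quantale A" by (rule quantale_axioms)
    fix p assume p: "p \<in> Spec A"
    then obtain q where "q \<in> Min_Spec A" "q \<sqsubseteq> p"
      using Min_Spec_below by blast
    then show "\<exists>!q. q \<in> Min_Spec A \<and> q \<sqsubseteq> p"
      using R p by blast
  qed
qed

text \<open>Every proper element lies below a prime, so two elements are comaximal exactly when no
  prime is above both.\<close>

lemma mp_quantale_iff_comaximal:
  "mp_quantale A \<longleftrightarrow> (\<forall>p\<in>Min_Spec A. \<forall>q\<in>Min_Spec A. p \<noteq> q \<longrightarrow> p \<squnion> q = \<top>)"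
proof -
  have "p \<squnion> q = \<top> \<longleftrightarrow> \<not> (\<exists>m\<in>Spec A. p \<sqsubseteq> m \<and> q \<sqsubseteq> m)" if "p \<in> Min_Spec A" "q \<in> Min_Spec A" for p q
  proof -
    have car: "p \<in> carrier A" "q \<in> carrier A"
      using that Min_Spec_carrier by auto
    have "p \<squnion> q \<sqsubseteq> m \<longleftrightarrow> p \<sqsubseteq> m \<and> q \<sqsubseteq> m" if "m \<in> Spec A" for m
      using join_le_iff car Spec_carrier[OF that] by blast
    moreover have "p \<squnion> q \<noteq> \<top> \<Longrightarrow> \<exists>m\<in>Spec A. p \<squnion> q \<sqsubseteq> m"
      using prime_above[OF join_closed[OF car]] by blast
    moreover have "\<not> \<top> \<sqsubseteq> m" if "m \<in> Spec A" for m
      using that by (rule top_not_le_Spec)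
    ultimately show ?thesis
      by metis
  qed
  then show ?thesis
    unfolding mp_quantale_iff by blast
qed

text \<open>A prime \<open>q\<close> outside the set lies above a minimal prime \<open>m\<close>
  other than \<open>p\<close>. A compact \<open>c\<close> below \<open>m\<close> is still comaximal
  with \<open>p\<close>, so \<open>V_above A c\<close> is a neighbourhood of \<open>q\<close> that
  misses \<open>V_above A p\<close>.\<close>

lemma mp_imp_closedin_V_above:
  assumes mp: "mp_quantale A" and p: "p \<in> Min_Spec A"
  shows "closedin (Spec_flat A) (V_above A p)"
proof -
  have "\<exists>c\<in>compact_elements A. c \<sqsubseteq> q \<and> V_above A c \<subseteq> Spec A - V_above A p"
    if q: "q \<in> Spec A - V_above A p" for q
  proof -
    obtain m where m: "m \<in> Min_Spec A" "m \<sqsubseteq> q"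
      using q Min_Spec_below[of q] by blast
    have car: "m \<in> carrier A" "p \<in> carrier A" "q \<in> carrier A"
      using m p q Min_Spec_carrier Spec_carrier by auto
    have "m \<noteq> p"
      using m q by (auto simp: V_above_def)
    then have "m \<squnion> p = \<top>"
      using mp m p unfolding mp_quantale_iff_comaximal by blast
    then obtain c where c: "c \<in> compact_elements A" "c \<sqsubseteq> m" "c \<squnion> p = \<top>"
      using rel_prime_compact[OF car(1,2)] by metis
    have cc: "c \<in> carrier A"
      using c compact_elements_carrier by blast
    have "c \<sqsubseteq> q"
      using le_trans[of c m q] c m cc car by blast
    moreover have "V_above A c \<inter> V_above A p = {}"
      unfolding V_above_join[OF cc car(2), symmetric] c(3)
      using top_not_le_Spec by (auto simp: V_above_def)
    then have "V_above A c \<subseteq> Spec A - V_above A p"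
      by (auto simp: V_above_def)
    ultimately show ?thesis
      using c(1) by blast
  qed
  then have "openin (Spec_flat A) (Spec A - V_above A p)"
    unfolding openin_Spec_flat_iff by blast
  then show ?thesis
    by (auto simp: closedin_def topspace_Spec_flat V_above_def)
qed

text \<open>Closed sets are closed under passing to smaller primes. So \<open>q'\<close>, lying
  below a prime above \<open>q\<close>, is itself above \<open>q\<close>, and minimality gives
  equality.\<close>

lemma closedin_V_above_imp_mp:
  assumes cl: "\<And>p. p \<in> Min_Spec A \<Longrightarrow> closedin (Spec_flat A) (V_above A p)"
  shows "mp_quantale A"
  unfolding mp_quantale_iff
proof (intro ballI impI)
  fix p q q' assume p: "p \<in> Spec A" and q: "q \<in> Min_Spec A" "q' \<in> Min_Spec A" "q \<sqsubseteq> p" "q' \<sqsubseteq> p"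
  have "p \<in> V_above A q"
    using p q by (simp add: V_above_def)
  then have "q' \<in> V_above A q"
    using closedin_Spec_flat_down[OF cl[OF q(1)]] q Min_Spec_imp_Spec by blast
  then have "q \<sqsubseteq> q'"
    by (simp add: V_above_def)
  then show "q = q'"
    using Min_SpecD[OF q(2) Min_Spec_imp_Spec[OF q(1)]] by blast
qed

text \<open>This is continuity of the retraction, phrased before the retraction is chosen: primes in
  the neighbourhood \<open>V_above A d\<close> have their minimal primes in
  \<open>V_above A c\<close>.\<close>

lemma mp_neighbourhood:
  assumes mp: "mp_quantale A" and q: "q \<in> Min_Spec A" and c: "c \<in> compact_elements A" "c \<sqsubseteq> q"
  obtains d where "d \<in> compact_elements A" "d \<sqsubseteq> q"
    "\<And>p m. \<lbrakk>p \<in> V_above A d; m \<in> Min_Spec A; m \<sqsubseteq> p\<rbrakk> \<Longrightarrow> c \<sqsubseteq> m"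
proof -
  let ?M = "{m \<in> Min_Spec A. \<not> c \<sqsubseteq> m}"
  \<comment> \<open>Comaximality with this one element excludes all minimal primes not above
    \<open>c\<close> simultaneously.\<close>
  let ?n = "\<Sqinter> ?M"
  have M: "?M \<subseteq> carrier A"
    using Min_Spec_carrier by auto
  have car: "q \<in> carrier A" "?n \<in> carrier A" "c \<in> carrier A"
    using Min_Spec_carrier[OF q] M compact_elements_carrier[OF c(1)] by auto
  have "q \<squnion> ?n = \<top>"
  proof (rule ccontr)
    assume "q \<squnion> ?n \<noteq> \<top>"
    then obtain r where r: "r \<in> Spec A" "q \<squnion> ?n \<sqsubseteq> r"
      using prime_above[OF join_closed[OF car(1,2)]] by blast
    then have le: "q \<sqsubseteq> r" "?n \<sqsubseteq> r"
      using join_le_iff car Spec_carrier[OF r(1)] by blast+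
    \<comment> \<open>Since \<open>?n\<close> is below \<open>r\<close>, such an \<open>s\<close> is
      not below the meet \<open>?n\<close>, hence not below some member of
      \<open>?M\<close>.\<close>
    have "\<exists>p\<in>Spec A. \<not> c \<sqsubseteq> p \<and> \<not> s \<sqsubseteq> p" if s: "s \<in> compact_elements A" "\<not> s \<sqsubseteq> r" for s
    proof -
      have sc: "s \<in> carrier A"
        using s compact_elements_carrier by blast
      then have "\<not> s \<sqsubseteq> ?n"
        using s le_trans[of s ?n r] le car Spec_carrier[OF r(1)] by blast
      then obtain m where "m \<in> ?M" "\<not> s \<sqsubseteq> m"
        using inf_greatest[OF M sc] by blast
      then show ?thesis
        using Min_Spec_imp_Spec by blast
    qed
    from exists_prime_below_not_above[OF r(1) c(1) this]
    obtain p where p: "p \<in> Spec A" "p \<sqsubseteq> r" "\<not> c \<sqsubseteq> p"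
      by blast
    obtain m where m: "m \<in> Min_Spec A" "m \<sqsubseteq> p"
      using Min_Spec_below p by blast
    then have "m \<sqsubseteq> r"
      using le_trans[of m p r] p Min_Spec_carrier Spec_carrier r by blast
    \<comment> \<open>Both minimal primes lie below \<open>r\<close>. Hence \<open>c\<close>, being
      below \<open>q\<close>, would be below \<open>p\<close>.\<close>
    then have "m = q"
      using mp r(1) m(1) q le(1) unfolding mp_quantale_iff by blast
    then have "c \<sqsubseteq> p"
      using le_trans[of c q p] c m car Spec_carrier[OF p(1)] by blast
    then show False using p by blast
  qed
  then obtain d where d: "d \<in> compact_elements A" "d \<sqsubseteq> q" "d \<squnion> ?n = \<top>"
    using rel_prime_compact[OF car(1,2)] by metis
  have "c \<sqsubseteq> m" if p: "p \<in> V_above A d" and m: "m \<in> Min_Spec A" "m \<sqsubseteq> p" for p m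
  proof (rule ccontr)
    assume "\<not> c \<sqsubseteq> m"
    \<comment> \<open>Now \<open>m\<close> belongs to \<open>?M\<close>, so \<open>p\<close> is
      above both \<open>d\<close> and \<open>?n\<close>, whose join is the top.\<close>
    then have "?n \<sqsubseteq> m"
      using inf_lower[OF M] m by blast
    have pS: "p \<in> Spec A" "d \<sqsubseteq> p"
      using p by (auto simp: V_above_def)
    then have "?n \<sqsubseteq> p"
      using le_trans[of ?n m p] \<open>?n \<sqsubseteq> m\<close> m car Min_Spec_carrier Spec_carrier by blast
    then have "\<top> \<sqsubseteq> p"
      unfolding d(3)[symmetric]
      using pS car d(1) compact_elements_carrier Spec_carrier by (intro join_le) auto
    then show False
      using top_not_le_Spec pS by blast
  qed
  then show thesis
    using that d by blast
qed

lemma topspace_Min_flat: "topspace (Min_flat A) = Min_Spec A"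
  by (auto simp: Min_flat_def topspace_Spec_flat Min_Spec_def)

text \<open>The map picks a minimal prime below each prime, and \<open>mp_neighbourhood\<close>
  makes preimages of open sets open. The inequality \<open>r p \<sqsubseteq> p\<close> is recorded
  for the proof of normality.\<close>

lemma mp_imp_retraction:
  assumes mp: "mp_quantale A"
  obtains r where "continuous_map (Spec_flat A) (Min_flat A) r" "\<And>p. p \<in> Min_Spec A \<Longrightarrow> r p = p"
    "\<And>p. p \<in> Spec A \<Longrightarrow> r p \<sqsubseteq> p"
proof -
  have "\<forall>p\<in>Spec A. \<exists>q. q \<in> Min_Spec A \<and> q \<sqsubseteq> p"
    using Min_Spec_below by blast
  then obtain r where r: "\<And>p. p \<in> Spec A \<Longrightarrow> r p \<in> Min_Spec A" "\<And>p. p \<in> Spec A \<Longrightarrow> r p \<sqsubseteq> p"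
    by metis
  have "openin (Spec_flat A) {p \<in> Spec A. r p \<in> U}" if U: "openin (Spec_flat A) U" for U
    unfolding openin_Spec_flat_iff
  proof (intro conjI ballI)
    fix p assume p: "p \<in> {p \<in> Spec A. r p \<in> U}"
    then obtain c where c: "c \<in> compact_elements A" "c \<sqsubseteq> r p" "V_above A c \<subseteq> U"
      using U unfolding openin_Spec_flat_iff by blast
    have rp: "r p \<in> Min_Spec A"
      using p r(1) by blast
    obtain d where d: "d \<in> compact_elements A" "d \<sqsubseteq> r p"
      and d': "\<And>p m. \<lbrakk>p \<in> V_above A d; m \<in> Min_Spec A; m \<sqsubseteq> p\<rbrakk> \<Longrightarrow> c \<sqsubseteq> m"
      using mp_neighbourhood[OF mp rp c(1,2)] by blast
    have "d \<sqsubseteq> p"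
      using le_trans[of d "r p" p] d r p compact_elements_carrier Min_Spec_carrier Spec_carrier by blast
    moreover have "r x \<in> U" if x: "x \<in> V_above A d" for x
    proof -
      have xS: "x \<in> Spec A"
        using x by (simp add: V_above_def)
      then have "r x \<in> V_above A c"
        using d'[OF x r(1) r(2)] r(1) Min_Spec_imp_Spec by (auto simp: V_above_def)
      then show ?thesis using c by blast
    qed
    ultimately show "\<exists>c\<in>compact_elements A. c \<sqsubseteq> p \<and> V_above A c \<subseteq> {p \<in> Spec A. r p \<in> U}"
      using d(1) by (intro bexI[of _ d]) (auto simp: V_above_def)
  qed blast
  then have "continuous_map (Spec_flat A) (Spec_flat A) r"
    using r(1) Min_Spec_imp_Spec by (force simp: continuous_map topspace_Spec_flat)
  then have "continuous_map (Spec_flat A) (Min_flat A) r"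
    using r(1) by (auto simp: Min_flat_def continuous_map_in_subtopology topspace_Spec_flat)
  moreover have "r p = p" if "p \<in> Min_Spec A" for p
    using Min_SpecD[OF that, of "r p"] Min_Spec_imp_Spec r that by blast
  ultimately show thesis
    using that r(2) by blast
qed

text \<open>For compact \<open>c\<close> below a minimal prime \<open>q\<close>, the preimage of
  \<open>V_above A c\<close> is open and contains \<open>q\<close>, hence contains every prime
  \<open>p\<close> above \<open>q\<close>. So \<open>q\<close> is below \<open>r p\<close>, and
  minimality of \<open>r p\<close> gives \<open>r p = q\<close>.\<close>

lemma retraction_imp_mp:
  assumes cont: "continuous_map (Spec_flat A) (Min_flat A) r"
    and id: "\<And>p. p \<in> Min_Spec A \<Longrightarrow> r p = p"
  shows "mp_quantale A"
proof -
  have eq: "r p = q" if p: "p \<in> Spec A" and q: "q \<in> Min_Spec A" "q \<sqsubseteq> p" for p q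
  proof -
    have cont': "continuous_map (Spec_flat A) (Spec_flat A) r"
      using cont by (simp add: Min_flat_def continuous_map_in_subtopology)
    have rp: "r p \<in> Min_Spec A"
      using cont p continuous_map_image_subset_topspace[OF cont]
      by (auto simp: topspace_Spec_flat topspace_Min_flat)
    have "q \<sqsubseteq> r p"
    proof (rule compact_le_imp_le)
      show "q \<in> carrier A" "r p \<in> carrier A"
        using q rp Min_Spec_carrier by auto
      fix c assume c: "c \<in> compact_elements A" "c \<sqsubseteq> q"
      have op: "openin (Spec_flat A) {x \<in> Spec A. r x \<in> V_above A c}"
        using openin_continuous_map_preimage[OF cont' openin_V_above[OF c(1)]]
        by (simp add: topspace_Spec_flat)
      have "q \<in> {x \<in> Spec A. r x \<in> V_above A c}"
        using id[OF q(1)] c Min_Spec_imp_Spec[OF q(1)] by (simp add: V_above_def)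
      from openin_Spec_flat_up[OF op this q(2) p] show "c \<sqsubseteq> r p"
        by (simp add: V_above_def)
    qed
    then show ?thesis
      using Min_SpecD[OF rp Min_Spec_imp_Spec[OF q(1)]] by simp
  qed
  show ?thesis
    unfolding mp_quantale_iff using eq by metis
qed

section \<open>Separation properties of the flat topology\<close>

text \<open>Applying \<open>rel_prime_compact\<close> on each side replaces two comaximal minimal
  primes by comaximal compact elements, whose basic open sets are disjoint.\<close>

lemma mp_imp_Hausdorff_Min_flat:
  assumes mp: "mp_quantale A"
  shows "Hausdorff_space (Min_flat A)"
  unfolding Hausdorff_space_def topspace_Min_flat
proof (intro allI impI, elim conjE)
  fix p q assume pq: "p \<in> Min_Spec A" "q \<in> Min_Spec A" "p \<noteq> q"
  have car: "p \<in> carrier A" "q \<in> carrier A"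
    using pq Min_Spec_carrier by auto
  have "p \<squnion> q = \<top>"
    using mp pq unfolding mp_quantale_iff_comaximal by blast
  then obtain d where d: "d \<in> compact_elements A" "d \<sqsubseteq> p" "d \<squnion> q = \<top>"
    using rel_prime_compact[OF car] by metis
  have dc: "d \<in> carrier A"
    using d compact_elements_carrier by blast
  have "q \<squnion> d = \<top>"
    using d(3) by (simp add: join_comm)
  then obtain e where e: "e \<in> compact_elements A" "e \<sqsubseteq> q" "e \<squnion> d = \<top>"
    using rel_prime_compact[OF car(2) dc] by metis
  have ec: "e \<in> carrier A"
    using e compact_elements_carrier by blast
  have "V_above A e \<inter> V_above A d = {}"
    unfolding V_above_join[OF ec dc, symmetric] e(3)
    using top_not_le_Spec by (auto simp: V_above_def)
  moreover have "openin (Min_flat A) (V_above A x \<inter> Min_Spec A)" if "x \<in> compact_elements A" for x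
    using openin_V_above[OF that] unfolding Min_flat_def by (rule openin_subtopology_Int)
  moreover have "p \<in> V_above A d" "q \<in> V_above A e"
    using d e pq Min_Spec_imp_Spec by (auto simp: V_above_def)
  ultimately show "\<exists>U V. openin (Min_flat A) U \<and> openin (Min_flat A) V \<and> p \<in> U \<and> q \<in> V \<and> disjnt U V"
    using d(1) e(1) pq
    by (intro exI[of _ "V_above A d \<inter> Min_Spec A"] exI[of _ "V_above A e \<inter> Min_Spec A"])
      (auto simp: disjnt_def)
qed

text \<open>
  A flat closed set is closed under passing to smaller primes, hence it is contained in the preimage,
  under the retraction, of its trace on the minimal primes.
\<close>

lemma mp_imp_normal:
  assumes mp: "mp_quantale A"
  shows "normal_space (Spec_flat A)"
proof -
  obtain r where r: "continuous_map (Spec_flat A) (Min_flat A) r"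
    "\<And>p. p \<in> Min_Spec A \<Longrightarrow> r p = p" "\<And>p. p \<in> Spec A \<Longrightarrow> r p \<sqsubseteq> p"
    using mp_imp_retraction[OF mp] by blast
  have rM: "r p \<in> Min_Spec A" if "p \<in> Spec A" for p
    using that continuous_map_image_subset_topspace[OF r(1)]
    by (auto simp: topspace_Spec_flat topspace_Min_flat)
  have im: "r ` Spec A = Min_Spec A"
  proof
    show "Min_Spec A \<subseteq> r ` Spec A"
      using r(2) Min_Spec_imp_Spec by (metis image_eqI subsetI)
  qed (use rM in blast)
  have "compactin (Min_flat A) (r ` Spec A)"
    using image_compactin[OF _ r(1)] compact_space_Spec_flat
    by (simp add: compact_space_def topspace_Spec_flat)
  then have "compact_space (Min_flat A)"
    by (simp add: im compact_space_def topspace_Min_flat)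
  then have normal: "normal_space (Min_flat A)"
    using compact_Hausdorff_or_regular_imp_normal_space mp_imp_Hausdorff_Min_flat[OF mp] by blast
  show ?thesis
    unfolding normal_space_def
  proof (intro allI impI, elim conjE)
    fix S T assume ST: "closedin (Spec_flat A) S" "closedin (Spec_flat A) T" "disjnt S T"
    have "closedin (Min_flat A) (S \<inter> Min_Spec A)" "closedin (Min_flat A) (T \<inter> Min_Spec A)"
      using ST closedin_subtopology unfolding Min_flat_def by blast+
    moreover have "disjnt (S \<inter> Min_Spec A) (T \<inter> Min_Spec A)"
      using ST(3) by (auto simp: disjnt_def)
    ultimately obtain U V where UV: "openin (Min_flat A) U" "openin (Min_flat A) V"
      "S \<inter> Min_Spec A \<subseteq> U" "T \<inter> Min_Spec A \<subseteq> V" "disjnt U V"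
      using normal unfolding normal_space_def by metis
    have in_pre: "S' \<subseteq> {p \<in> Spec A. r p \<in> W}"
      if S': "closedin (Spec_flat A) S'" and W: "S' \<inter> Min_Spec A \<subseteq> W" for S' W
    proof
      fix p assume p: "p \<in> S'"
      then have pS: "p \<in> Spec A"
        using closedin_subset[OF S'] by (auto simp: topspace_Spec_flat)
      have "r p \<in> S'"
        using closedin_Spec_flat_down[OF S' p r(3)[OF pS] Min_Spec_imp_Spec[OF rM[OF pS]]] .
      then show "p \<in> {p \<in> Spec A. r p \<in> W}"
        using W rM[OF pS] pS by blast
    qed
    have pre: "openin (Spec_flat A) {p \<in> Spec A. r p \<in> W}" if "openin (Min_flat A) W" for W
      using openin_continuous_map_preimage[OF r(1) that] by (simp add: topspace_Spec_flat)
    show "\<exists>U V. openin (Spec_flat A) U \<and> openin (Spec_flat A) V \<and> S \<subseteq> U \<and> T \<subseteq> V \<and> disjnt U V"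
    proof (intro exI conjI)
      show "disjnt {p \<in> Spec A. r p \<in> U} {p \<in> Spec A. r p \<in> V}"
        using UV(5) by (auto simp: disjnt_def)
    qed (use pre UV in_pre ST in blast)+
  qed
qed

text \<open>A prime other than \<open>q\<close> is not below \<open>q\<close> by minimality, and a
  compact element witnesses this.\<close>

lemma closedin_Min_singleton:
  assumes q: "q \<in> Min_Spec A"
  shows "closedin (Spec_flat A) {q}"
proof -
  have "\<exists>c\<in>compact_elements A. c \<sqsubseteq> p \<and> V_above A c \<subseteq> Spec A - {q}" if p: "p \<in> Spec A - {q}" for p
  proof -
    have "\<not> p \<sqsubseteq> q"
      using Min_SpecD[OF q, of p] p by blast
    then obtain c where c: "c \<in> compact_elements A" "c \<sqsubseteq> p" "\<not> c \<sqsubseteq> q"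
      using compact_le_imp_le[of p q] p Spec_carrier Min_Spec_carrier[OF q] by blast
    then show ?thesis
      by (intro bexI[of _ c]) (auto simp: V_above_def)
  qed
  then have "openin (Spec_flat A) (Spec A - {q})"
    unfolding openin_Spec_flat_iff by blast
  then show ?thesis
    using Min_Spec_imp_Spec[OF q] by (simp add: closedin_def topspace_Spec_flat)
qed

text \<open>Open neighbourhoods separating two minimal primes cannot both contain a prime above
  them, yet open sets are closed under passing to larger primes.\<close>

lemma normal_imp_mp:
  assumes normal: "normal_space (Spec_flat A)"
  shows "mp_quantale A"
  unfolding mp_quantale_iff
proof (intro ballI impI, rule ccontr)
  fix p q q' assume p: "p \<in> Spec A" and q: "q \<in> Min_Spec A" "q' \<in> Min_Spec A" "q \<sqsubseteq> p" "q' \<sqsubseteq> p"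
    and "q \<noteq> q'"
  then have "disjnt {q} {q'}"
    by simp
  then obtain U V where UV: "openin (Spec_flat A) U" "openin (Spec_flat A) V" "{q} \<subseteq> U" "{q'} \<subseteq> V" "disjnt U V"
    using normal closedin_Min_singleton[OF q(1)] closedin_Min_singleton[OF q(2)]
    unfolding normal_space_def by metis
  then have "p \<in> U" "p \<in> V"
    using openin_Spec_flat_up p q by blast+
  then show False
    using UV(5) by (auto simp: disjnt_def)
qed

end

section \<open>Radical elements and the frame that they form\<close>

context quantale
begin

text \<open>Closure under all meets, the empty one included, is enough. The multiplication
  \<open>m\<close> is arbitrary because only the order matters, so the lemma serves
  \<open>R(A)\<close> and \<open>[a)\<close> alike.\<close>

lemma complete_lattice_restrict:
  assumes X: "X \<subseteq> carrier A" and inf: "\<And>S. S \<subseteq> X \<Longrightarrow> \<Sqinter> S \<in> X"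
  shows "complete_lattice (A\<lparr>carrier := X, qmult := m\<rparr>)" (is "complete_lattice ?B")
proof -
  have po: "partial_order ?B"
    using X by unfold_locales (auto simp: eq_is_equal intro: le_antisym le_trans)
  show ?thesis
  proof (rule partial_order.complete_latticeI[OF po])
    fix S assume "S \<subseteq> carrier ?B"
    then have S: "S \<subseteq> X" by simp
    \<comment> \<open>The join in the restricted order is the meet of the upper bounds that lie in
      \<open>X\<close>.\<close>
    let ?U = "{u \<in> X. \<forall>s\<in>S. s \<sqsubseteq> u}"
    have U: "?U \<subseteq> carrier A" "\<Sqinter> ?U \<in> X" "S \<subseteq> carrier A"
      using X S inf[of ?U] by auto
    have "s \<sqsubseteq> \<Sqinter> ?U" if "s \<in> S" for s
      using that U by (intro inf_greatest) auto
    moreover have "\<Sqinter> ?U \<sqsubseteq> u" if "u \<in> ?U" for u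
      using that U by (intro inf_lower) auto
    moreover have "Upper ?B S = ?U"
      using S by (auto simp: Upper_def)
    ultimately have "least ?B (\<Sqinter> ?U) (Upper ?B S)"
      using U(2) by (simp add: least_def)
    then show "\<exists>s. least ?B s (Upper ?B S)" ..
    have "\<Sqinter> S \<sqsubseteq> s" if "s \<in> S" for s
      using that U(3) by (intro inf_lower) auto
    moreover have "z \<sqsubseteq> \<Sqinter> S" if "z \<in> X" "\<forall>s\<in>S. z \<sqsubseteq> s" for z
      using that U X by (intro inf_greatest) auto
    moreover have "Lower ?B S = {z \<in> X. \<forall>s\<in>S. z \<sqsubseteq> s}"
      using S by (auto simp: Lower_def)
    ultimately have "greatest ?B (\<Sqinter> S) (Lower ?B S)"
      using inf[OF S] by (simp add: greatest_def)
    then show "\<exists>i. greatest ?B i (Lower ?B S)" ..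
  qed
qed

lemma rho_closed: "rho A a \<in> carrier A"
  unfolding rho_def by (rule inf_closed) (auto intro: Spec_carrier)

lemma le_rho: "a \<in> carrier A \<Longrightarrow> a \<sqsubseteq> rho A a"
  unfolding rho_def by (rule inf_greatest) (auto intro: Spec_carrier)

lemma rho_le: "\<lbrakk>p \<in> Spec A; a \<sqsubseteq> p\<rbrakk> \<Longrightarrow> rho A a \<sqsubseteq> p"
  unfolding rho_def by (rule inf_lower) (auto intro: Spec_carrier)

text \<open>A radical element is the meet of the primes above it. This reduces inequalities with a
  radical right-hand side to primes.\<close>

lemma le_radicalI:
  assumes "x \<in> carrier A" "rho A b = b" "\<And>p. \<lbrakk>p \<in> Spec A; b \<sqsubseteq> p\<rbrakk> \<Longrightarrow> x \<sqsubseteq> p"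
  shows "x \<sqsubseteq> b"
proof -
  have "x \<sqsubseteq> rho A b"
    unfolding rho_def using assms by (intro inf_greatest) (auto intro: Spec_carrier)
  then show ?thesis using assms by simp
qed

lemma radicalI:
  assumes "b \<in> carrier A" "rho A b \<sqsubseteq> b"
  shows "rho A b = b"
  using assms le_rho rho_closed by (blast intro: le_antisym)

lemma rho_Spec: "p \<in> Spec A \<Longrightarrow> rho A p = p"
  by (intro radicalI rho_le) (auto intro: Spec_carrier)

lemma rho_rho: "rho A (rho A a) = rho A a"
proof (rule radicalI)
  show "rho A (rho A a) \<sqsubseteq> rho A a"
    unfolding rho_def[of A a]
    by (rule inf_greatest) (auto intro: Spec_carrier rho_closed rho_le simp flip: rho_def)
qed (rule rho_closed)

text \<open>A prime above a member \<open>s\<close> is above the meet, hence above the radical of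
  the meet. As \<open>s\<close> is the meet of the primes above it, that radical is below
  \<open>s\<close>.\<close>

lemma rho_Inf:
  assumes S: "S \<subseteq> carrier A" "\<And>s. s \<in> S \<Longrightarrow> rho A s = s"
  shows "rho A (\<Sqinter> S) = \<Sqinter> S"
proof (rule radicalI)
  show "rho A (\<Sqinter> S) \<sqsubseteq> \<Sqinter> S"
  proof (rule inf_greatest[OF S(1) rho_closed])
    fix s assume s: "s \<in> S"
    show "rho A (\<Sqinter> S) \<sqsubseteq> s"
    proof (rule le_radicalI[OF rho_closed S(2)[OF s]])
      fix p assume p: "p \<in> Spec A" "s \<sqsubseteq> p"
      have "\<Sqinter> S \<sqsubseteq> p"
        using le_trans[of "\<Sqinter> S" s p] inf_lower[OF S(1) s] p s S(1) Spec_carrier by auto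
      then show "rho A (\<Sqinter> S) \<sqsubseteq> p"
        using p rho_le by blast
    qed
  qed
qed (use S in simp)

text \<open>Minimal primes are determined by the set of primes and the order on it, so the
  multiplication enters only through \<open>Spec\<close>.\<close>

lemma mp_quantale_cong:
  assumes "quantale B" "Spec B = Spec A" "le B = le A"
  shows "mp_quantale B \<longleftrightarrow> mp_quantale A"
  using assms quantale_axioms
  by (simp add: mp_quantale_def mp_quantale_axioms_def Min_Spec_def)

lemma radical_frame_sel:
  "carrier (radical_frame A) = {a \<in> carrier A. rho A a = a}"
  "le (radical_frame A) = le A"
  "qmult (radical_frame A) = (\<lambda>x y. x \<sqinter> y)"
  by (simp_all add: radical_frame_def)

lemma complete_lattice_radical_frame: "complete_lattice (radical_frame A)"
  unfolding radical_frame_def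
proof (rule complete_lattice_restrict)
  fix S assume "S \<subseteq> {a \<in> carrier A. rho A a = a}"
  then have "S \<subseteq> carrier A" "\<And>s. s \<in> S \<Longrightarrow> rho A s = s"
    by auto
  then show "\<Sqinter> S \<in> {a \<in> carrier A. rho A a = a}"
    using rho_Inf by simp
qed blast

text \<open>Distributivity is tested at primes, where products and meets behave alike. Joins in
  \<open>R(A)\<close> are handled through their universal property rather than through the formula
  with \<open>rho\<close>.\<close>

lemma frame_radical_frame: "frame (radical_frame A)"
proof -
  interpret R: complete_lattice "radical_frame A"
    by (rule complete_lattice_radical_frame)
  let ?R = "radical_frame A"
  note sel = radical_frame_sel
  have meet_R: "x \<sqinter> y \<in> carrier ?R" if "x \<in> carrier ?R" "y \<in> carrier ?R" for x y
    using that rho_Inf[of "{x, y}"] by (auto simp: sel meet_def)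
  \<comment> \<open>The multiplication is the meet of \<open>A\<close>, while the frame axiom speaks
    of the meet computed in \<open>R(A)\<close>.\<close>
  have meet_eq: "x \<sqinter> y = x \<sqinter>\<^bsub>?R\<^esub> y" if xy: "x \<in> carrier ?R" "y \<in> carrier ?R" for x y
  proof (rule le_antisym)
    have car: "x \<in> carrier A" "y \<in> carrier A" "x \<sqinter>\<^bsub>?R\<^esub> y \<in> carrier A"
      using xy R.meet_closed[OF xy] by (auto simp: sel)
    show "x \<sqinter> y \<sqsubseteq> x \<sqinter>\<^bsub>?R\<^esub> y"
      using R.meet_le[of "x \<sqinter> y" x y] meet_left[of x y] meet_right[of x y] meet_R xy car by (simp add: sel)
    show "x \<sqinter>\<^bsub>?R\<^esub> y \<sqsubseteq> x \<sqinter> y"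
      using R.meet_left[OF xy] R.meet_right[OF xy] car by (intro meet_le) (auto simp: sel)
    show "x \<sqinter> y \<in> carrier A" "x \<sqinter>\<^bsub>?R\<^esub> y \<in> carrier A"
      using car by auto
  qed
  have "quantale ?R"
  proof (intro quantale.intro quantale_axioms.intro)
    show "complete_lattice ?R" by (rule R.complete_lattice_axioms)
    show "x \<cdot>\<^bsub>?R\<^esub> y \<in> carrier ?R" if "x \<in> carrier ?R" "y \<in> carrier ?R" for x y
      using meet_R[OF that] by (simp add: sel)
    show "(x \<cdot>\<^bsub>?R\<^esub> y) \<cdot>\<^bsub>?R\<^esub> z = x \<cdot>\<^bsub>?R\<^esub> (y \<cdot>\<^bsub>?R\<^esub> z)"
      if "x \<in> carrier ?R" "y \<in> carrier ?R" "z \<in> carrier ?R" for x y z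
      using that by (auto simp: sel intro: meet_assoc)
    show "x \<cdot>\<^bsub>?R\<^esub> y = y \<cdot>\<^bsub>?R\<^esub> x" for x y
      by (simp add: sel meet_comm)
    show "x \<cdot>\<^bsub>?R\<^esub> \<top>\<^bsub>?R\<^esub> = x" if x: "x \<in> carrier ?R" for x
      using x R.top_higher[OF x] R.top_closed meet_left[of x "\<top>\<^bsub>?R\<^esub>"]
        meet_le[of x x "\<top>\<^bsub>?R\<^esub>"] by (auto simp: sel intro: le_antisym)
    fix x S assume x: "x \<in> carrier ?R" and S: "S \<subseteq> carrier ?R"
    let ?T = "(\<lambda>s. x \<cdot>\<^bsub>?R\<^esub> s) ` S"
    have T: "?T \<subseteq> carrier ?R"
      using meet_R x S by (auto simp: radical_frame_sel(3))
    have xA: "x \<in> carrier A" and SA: "S \<subseteq> carrier A"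
      using x S by (auto simp: sel)
    have sup: "\<Squnion>\<^bsub>?R\<^esub> S \<in> carrier ?R" "\<Squnion>\<^bsub>?R\<^esub> ?T \<in> carrier ?R"
      using R.sup_closed S T by auto
    then have supA: "\<Squnion>\<^bsub>?R\<^esub> S \<in> carrier A" "\<Squnion>\<^bsub>?R\<^esub> ?T \<in> carrier A" "rho A (\<Squnion>\<^bsub>?R\<^esub> ?T) = \<Squnion>\<^bsub>?R\<^esub> ?T"
      by (auto simp: sel)
    have "x \<sqinter> \<Squnion>\<^bsub>?R\<^esub> S \<sqsubseteq> \<Squnion>\<^bsub>?R\<^esub> ?T"
    proof (rule le_radicalI)
      show "x \<sqinter> \<Squnion>\<^bsub>?R\<^esub> S \<in> carrier A" "rho A (\<Squnion>\<^bsub>?R\<^esub> ?T) = \<Squnion>\<^bsub>?R\<^esub> ?T"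
        using xA supA by auto
      fix p assume p: "p \<in> Spec A" "\<Squnion>\<^bsub>?R\<^esub> ?T \<sqsubseteq> p"
      have pc: "p \<in> carrier A" using p Spec_carrier by blast
      have xs: "x \<sqsubseteq> p \<or> s \<sqsubseteq> p" if s: "s \<in> S" for s
      proof -
        have sA: "s \<in> carrier A" using s SA by auto
        have "x \<cdot> s \<sqsubseteq> x \<sqinter> s"
          using xA sA by (intro meet_le qmult_le_left qmult_le_right) auto
        moreover have "x \<sqinter> s \<sqsubseteq> \<Squnion>\<^bsub>?R\<^esub> ?T"
          using R.sup_upper[OF T, of "x \<sqinter> s"] s by (auto simp: sel)
        ultimately have "x \<cdot> s \<sqsubseteq> p"
          using le_trans[of "x \<cdot> s" "x \<sqinter> s" "\<Squnion>\<^bsub>?R\<^esub> ?T"] le_trans[of "x \<cdot> s" "\<Squnion>\<^bsub>?R\<^esub> ?T" p]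
            xA sA supA p pc by auto
        then show ?thesis
          using SpecD(3)[OF p(1) xA sA] by blast
      qed
      \<comment> \<open>The prime \<open>p\<close> is itself radical, so it is an upper bound of
        \<open>S\<close> inside \<open>R(A)\<close>.\<close>
      have "\<Squnion>\<^bsub>?R\<^esub> S \<sqsubseteq> p" if "\<not> x \<sqsubseteq> p"
      proof -
        have "s \<sqsubseteq> p" if "s \<in> S" for s
          using xs that \<open>\<not> x \<sqsubseteq> p\<close> by blast
        then show ?thesis
          using R.sup_least[OF S, of p] pc rho_Spec[OF p(1)] by (simp add: sel)
      qed
      then have "x \<sqsubseteq> p \<or> \<Squnion>\<^bsub>?R\<^esub> S \<sqsubseteq> p"
        by blast
      then show "x \<sqinter> \<Squnion>\<^bsub>?R\<^esub> S \<sqsubseteq> p"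
        using meet_left[OF xA supA(1)] meet_right[OF xA supA(1)] xA supA(1) pc
          le_trans[of "x \<sqinter> \<Squnion>\<^bsub>?R\<^esub> S" x p] le_trans[of "x \<sqinter> \<Squnion>\<^bsub>?R\<^esub> S" "\<Squnion>\<^bsub>?R\<^esub> S" p] by auto
    qed
    moreover have "\<Squnion>\<^bsub>?R\<^esub> ?T \<sqsubseteq> x \<sqinter> \<Squnion>\<^bsub>?R\<^esub> S"
    proof -
      have "x \<sqinter> s \<sqsubseteq> x \<sqinter> \<Squnion>\<^bsub>?R\<^esub> S" if s: "s \<in> S" for s
      proof (rule meet_le)
        have sA: "s \<in> carrier A" using s SA by auto
        show "x \<sqinter> s \<sqsubseteq> x"
          using xA sA by (rule meet_left)
        show "x \<sqinter> s \<sqsubseteq> \<Squnion>\<^bsub>?R\<^esub> S"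
          using meet_right[OF xA sA] R.sup_upper[OF S s] le_trans[of "x \<sqinter> s" s] xA sA supA
          by (auto simp: sel)
        show "x \<sqinter> s \<in> carrier A" "x \<in> carrier A" "\<Squnion>\<^bsub>?R\<^esub> S \<in> carrier A"
          using xA sA supA by auto
      qed
      then have "t \<sqsubseteq>\<^bsub>?R\<^esub> x \<sqinter> \<Squnion>\<^bsub>?R\<^esub> S" if "t \<in> ?T" for t
        using that by (auto simp: radical_frame_sel(2,3))
      then have "\<Squnion>\<^bsub>?R\<^esub> ?T \<sqsubseteq>\<^bsub>?R\<^esub> x \<sqinter> \<Squnion>\<^bsub>?R\<^esub> S"
        by (rule R.sup_least[OF T meet_R[OF x sup(1)]])
      then show ?thesis
        by (simp only: radical_frame_sel(2))
    qed
    ultimately have "x \<sqinter> \<Squnion>\<^bsub>?R\<^esub> S = \<Squnion>\<^bsub>?R\<^esub> ?T"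
      using xA supA by (intro le_antisym) auto
    then show "x \<cdot>\<^bsub>?R\<^esub> \<Squnion>\<^bsub>?R\<^esub> S = \<Squnion>\<^bsub>?R\<^esub> ?T"
      by (simp add: radical_frame_sel(3))
  qed
  then show ?thesis
    using meet_eq by (intro frame.intro frame_axioms.intro) (simp_all add: radical_frame_sel(3))
qed

text \<open>One inclusion replaces \<open>a\<close> and \<open>b\<close> by their radicals; the
  other uses that primes are radical and that products lie below meets.\<close>

lemma Spec_radical_frame: "Spec (radical_frame A) = Spec A"
proof -
  interpret R: frame "radical_frame A"
    by (rule frame_radical_frame)
  let ?R = "radical_frame A"
  note sel = radical_frame_sel
  have "\<top> \<in> carrier ?R"
    using radicalI[of \<top>] rho_closed by (auto simp: sel)
  then have top: "\<top>\<^bsub>?R\<^esub> = \<top>"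
    using R.top_higher[of \<top>] R.top_closed by (auto simp: sel intro: le_antisym)
  show ?thesis
  proof (intro equalityI subsetI)
    fix p assume p: "p \<in> Spec ?R"
    have pc: "p \<in> carrier A" "rho A p = p"
      using R.Spec_carrier[OF p] by (auto simp: sel)
    show "p \<in> Spec A"
    proof (rule SpecI)
      show "p \<in> carrier A" "\<not> \<top> \<sqsubseteq> p"
        using pc R.top_not_le_Spec[OF p] by (auto simp: sel top)
      fix a b assume ab: "a \<in> carrier A" "b \<in> carrier A" "a \<cdot> b \<sqsubseteq> p"
      have rc: "rho A a \<in> carrier ?R" "rho A b \<in> carrier ?R"
        using ab by (auto simp: sel rho_closed rho_rho)
      \<comment> \<open>As \<open>p\<close> is radical, it suffices to look at primes
        \<open>q\<close> of \<open>A\<close> above \<open>p\<close>; these are above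
        \<open>a\<close> or \<open>b\<close>, hence above its radical.\<close>
      have "rho A a \<sqinter> rho A b \<sqsubseteq> p"
      proof (rule le_radicalI[OF _ pc(2)])
        show mc: "rho A a \<sqinter> rho A b \<in> carrier A"
          by (simp add: rho_closed)
        fix q assume q: "q \<in> Spec A" "p \<sqsubseteq> q"
        then have "a \<cdot> b \<sqsubseteq> q"
          using le_trans[of "a \<cdot> b" p q] ab pc Spec_carrier by auto
        then have "rho A a \<sqsubseteq> q \<or> rho A b \<sqsubseteq> q"
          using SpecD(3)[OF q(1) ab(1,2)] rho_le[OF q(1)] by blast
        then show "rho A a \<sqinter> rho A b \<sqsubseteq> q"
          using le_trans[of "rho A a \<sqinter> rho A b" "rho A a" q] le_trans[of "rho A a \<sqinter> rho A b" "rho A b" q]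
            meet_left[OF rho_closed rho_closed, of a b] meet_right[OF rho_closed rho_closed, of a b]
            mc Spec_carrier[OF q(1)] rho_closed by auto
      qed
      then have "rho A a \<sqsubseteq> p \<or> rho A b \<sqsubseteq> p"
        using SpecD(3)[OF p rc] by (simp add: sel)
      then show "a \<sqsubseteq> p \<or> b \<sqsubseteq> p"
        using le_rho ab pc le_trans[of a "rho A a" p] le_trans[of b "rho A b" p] rho_closed by auto
    qed
  next
    fix p assume p: "p \<in> Spec A"
    have pc: "p \<in> carrier A" using p by (rule Spec_carrier)
    show "p \<in> Spec ?R"
    proof (rule R.SpecI)
      show "p \<in> carrier ?R" "\<not> \<top>\<^bsub>?R\<^esub> \<sqsubseteq>\<^bsub>?R\<^esub> p"
        using pc rho_Spec[OF p] top_not_le_Spec[OF p] by (auto simp: sel top)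
      fix a b assume ab: "a \<in> carrier ?R" "b \<in> carrier ?R" "a \<cdot>\<^bsub>?R\<^esub> b \<sqsubseteq>\<^bsub>?R\<^esub> p"
      then have ab': "a \<in> carrier A" "b \<in> carrier A" "a \<sqinter> b \<sqsubseteq> p"
        by (auto simp: sel)
      have "a \<cdot> b \<sqsubseteq> a \<sqinter> b"
        using ab' by (intro meet_le qmult_le_left qmult_le_right) auto
      then have "a \<cdot> b \<sqsubseteq> p"
        using le_trans[of "a \<cdot> b" "a \<sqinter> b" p] ab' pc by auto
      then show "a \<sqsubseteq>\<^bsub>?R\<^esub> p \<or> b \<sqsubseteq>\<^bsub>?R\<^esub> p"
        using SpecD(3)[OF p ab'(1,2)] by (simp add: sel)
    qed
  qed
qed

lemma mp_frame_radical_frame_iff: "mp_frame (radical_frame A) \<longleftrightarrow> mp_quantale A"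
proof -
  interpret R: frame "radical_frame A"
    by (rule frame_radical_frame)
  have "mp_quantale (radical_frame A) \<longleftrightarrow> mp_quantale A"
    by (intro mp_quantale_cong R.quantale_axioms Spec_radical_frame radical_frame_sel(2))
  then show ?thesis
    using R.frame_axioms by (simp add: mp_frame_def)
qed

section \<open>The up-sets \<open>[a)\<close> and their primes\<close>

lemma up_quantale_sel:
  "carrier (up_quantale A a) = {x \<in> carrier A. a \<sqsubseteq> x}"
  "le (up_quantale A a) = le A"
  "qmult (up_quantale A a) = (\<lambda>x y. x \<cdot> y \<squnion> a)"
  by (simp_all add: up_quantale_def)

lemma complete_lattice_up_quantale:
  assumes "a \<in> carrier A"
  shows "complete_lattice (up_quantale A a)"
  unfolding up_quantale_def
proof (rule complete_lattice_restrict)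
  fix S assume "S \<subseteq> {x \<in> carrier A. a \<sqsubseteq> x}"
  then have "S \<subseteq> carrier A" "\<And>s. s \<in> S \<Longrightarrow> a \<sqsubseteq> s"
    by auto
  then show "\<Sqinter> S \<in> {x \<in> carrier A. a \<sqsubseteq> x}"
    using assms by (simp add: inf_greatest)
qed blast

lemma top_up_quantale:
  assumes a: "a \<in> carrier A"
  shows "\<top>\<^bsub>up_quantale A a\<^esub> = \<top>"
proof -
  interpret B: complete_lattice "up_quantale A a"
    using a by (rule complete_lattice_up_quantale)
  have "\<top> \<in> carrier (up_quantale A a)"
    using a by (simp add: up_quantale_sel)
  then show ?thesis
    using B.top_higher[of \<top>] B.top_closed by (auto simp: up_quantale_sel intro: le_antisym)
qed

lemma le_join_trans_left:
  "\<lbrakk>x \<sqsubseteq> y; x \<in> carrier A; y \<in> carrier A; z \<in> carrier A\<rbrakk> \<Longrightarrow> x \<sqsubseteq> y \<squnion> z"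
  using le_trans[of x y "y \<squnion> z"] join_left[of y z] by simp

lemma quantale_up_quantale:
  assumes a: "a \<in> carrier A"
  shows "quantale (up_quantale A a)"
proof -
  let ?B = "up_quantale A a"
  interpret B: complete_lattice ?B
    using a by (rule complete_lattice_up_quantale)
  note sel = up_quantale_sel
  \<comment> \<open>The extra term \<open>z \<cdot> a\<close> is absorbed by \<open>a\<close>, so
    the inner join with \<open>a\<close> may be dropped.\<close>
  have assoc: "(x \<cdot> y \<squnion> a) \<cdot> z \<squnion> a = (x \<cdot> y) \<cdot> z \<squnion> a"
    if "x \<in> carrier A" "y \<in> carrier A" "z \<in> carrier A" for x y z
  proof -
    have "(x \<cdot> y \<squnion> a) \<cdot> z = (x \<cdot> y) \<cdot> z \<squnion> z \<cdot> a"
      using that a qmult_join[of z "x \<cdot> y" a] by (simp add: qmult_comm[of _ z])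
    moreover have "z \<cdot> a \<squnion> a = a"
      using that a qmult_le_right[of z a] by (auto intro!: le_antisym join_right simp: join_le_iff)
    ultimately show ?thesis
      using that a by (simp add: join_assoc)
  qed
  show ?thesis
  proof (intro quantale.intro quantale_axioms.intro)
    show "complete_lattice ?B" by (rule B.complete_lattice_axioms)
    show "x \<cdot>\<^bsub>?B\<^esub> y \<in> carrier ?B" if "x \<in> carrier ?B" "y \<in> carrier ?B" for x y
      using that a by (auto simp: sel join_right)
    show "(x \<cdot>\<^bsub>?B\<^esub> y) \<cdot>\<^bsub>?B\<^esub> z = x \<cdot>\<^bsub>?B\<^esub> (y \<cdot>\<^bsub>?B\<^esub> z)"
      if "x \<in> carrier ?B" "y \<in> carrier ?B" "z \<in> carrier ?B" for x y z
    proof -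
      have car: "x \<in> carrier A" "y \<in> carrier A" "z \<in> carrier A"
        using that by (auto simp: sel)
      have "x \<cdot> (y \<cdot> z \<squnion> a) \<squnion> a = (y \<cdot> z \<squnion> a) \<cdot> x \<squnion> a"
        using car a by (simp add: qmult_comm)
      also have "\<dots> = (y \<cdot> z) \<cdot> x \<squnion> a"
        by (rule assoc[OF car(2,3,1)])
      also have "\<dots> = (x \<cdot> y) \<cdot> z \<squnion> a"
        using car by (simp add: qmult_assoc[of x y z] qmult_comm[of "y \<cdot> z" x])
      finally show ?thesis
        using assoc car by (simp add: sel)
    qed
    show "x \<cdot>\<^bsub>?B\<^esub> y = y \<cdot>\<^bsub>?B\<^esub> x" if "x \<in> carrier ?B" "y \<in> carrier ?B" for x y
      using that by (simp add: sel qmult_comm)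
    show "x \<cdot>\<^bsub>?B\<^esub> \<top>\<^bsub>?B\<^esub> = x" if x: "x \<in> carrier ?B" for x
    proof -
      have car: "x \<in> carrier A" "a \<sqsubseteq> x"
        using x by (auto simp: sel)
      have "x \<squnion> a = x"
        using car a by (intro le_antisym) (auto simp: join_le_iff join_left)
      then show ?thesis
        using car by (simp add: sel top_up_quantale[OF a] qmult_top)
    qed
    fix x S assume x: "x \<in> carrier ?B" and S: "S \<subseteq> carrier ?B"
    let ?T = "(\<lambda>s. x \<cdot>\<^bsub>?B\<^esub> s) ` S"
    \<comment> \<open>Adjoining \<open>a\<close> covers the empty family, whose join in
      \<open>[a)\<close> is \<open>a\<close> and not the bottom of \<open>A\<close>. The additional
      product \<open>x \<cdot> a\<close> is harmless, being below \<open>a\<close>.\<close>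
    have xA: "x \<in> carrier A" and SA: "insert a S \<subseteq> carrier A"
      using x S a by (auto simp: sel)
    have sA: "s \<in> carrier A" if "s \<in> S" for s
      using that SA by blast
    have T: "?T \<subseteq> carrier ?B"
      using xA sA a by (auto simp: sel join_right)
    have sup: "\<Squnion>\<^bsub>?B\<^esub> S \<in> carrier A" "\<Squnion>\<^bsub>?B\<^esub> ?T \<in> carrier A" "a \<sqsubseteq> \<Squnion>\<^bsub>?B\<^esub> ?T"
      using B.sup_closed[OF S] B.sup_closed[OF T] by (auto simp: up_quantale_sel(1))
    have U: "\<Squnion> (insert a S) \<in> carrier A"
      using SA by (rule sup_closed)
    have up: "s \<sqsubseteq> \<Squnion> (insert a S)" if "s \<in> insert a S" for s
      using SA that by (rule sup_upper)
    have "\<Squnion>\<^bsub>?B\<^esub> S \<sqsubseteq> \<Squnion> (insert a S)"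
      using B.sup_least[OF S, of "\<Squnion> (insert a S)"] up U by (simp add: up_quantale_sel(1,2))
    then have "x \<cdot> \<Squnion>\<^bsub>?B\<^esub> S \<sqsubseteq> x \<cdot> \<Squnion> (insert a S)"
      using xA sup U by (intro qmult_mono)
    moreover have "x \<cdot> \<Squnion> (insert a S) \<sqsubseteq> \<Squnion>\<^bsub>?B\<^esub> ?T"
      unfolding qmult_sup_distrib[OF xA SA]
    proof (rule sup_least)
      show "(\<lambda>s. x \<cdot> s) ` insert a S \<subseteq> carrier A"
        using xA SA by auto
      have "x \<cdot> a \<sqsubseteq> \<Squnion>\<^bsub>?B\<^esub> ?T"
        using le_trans[OF qmult_le_right[OF xA a] sup(3)] xA a sup by simp
      moreover have "x \<cdot> s \<sqsubseteq> \<Squnion>\<^bsub>?B\<^esub> ?T" if s: "s \<in> S" for s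
      proof -
        have "x \<cdot> s \<squnion> a \<sqsubseteq> \<Squnion>\<^bsub>?B\<^esub> ?T"
          using B.sup_upper[OF T, of "x \<cdot> s \<squnion> a"] s by (auto simp: up_quantale_sel(2,3))
        then show ?thesis
          using join_le_iff[of "x \<cdot> s" a] xA sA[OF s] a sup by simp
      qed
      ultimately show "y \<sqsubseteq> \<Squnion>\<^bsub>?B\<^esub> ?T" if "y \<in> (\<lambda>s. x \<cdot> s) ` insert a S" for y
        using that by blast
    qed (rule sup)
    ultimately have "x \<cdot> \<Squnion>\<^bsub>?B\<^esub> S \<sqsubseteq> \<Squnion>\<^bsub>?B\<^esub> ?T"
      using le_trans[of "x \<cdot> \<Squnion>\<^bsub>?B\<^esub> S" "x \<cdot> \<Squnion> (insert a S)"] xA sup U by simp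
    then have "x \<cdot> \<Squnion>\<^bsub>?B\<^esub> S \<squnion> a \<sqsubseteq> \<Squnion>\<^bsub>?B\<^esub> ?T"
      using xA a sup by (simp add: join_le_iff)
    moreover have "\<Squnion>\<^bsub>?B\<^esub> ?T \<sqsubseteq> x \<cdot> \<Squnion>\<^bsub>?B\<^esub> S \<squnion> a"
    proof -
      have "x \<cdot> s \<squnion> a \<sqsubseteq> x \<cdot> \<Squnion>\<^bsub>?B\<^esub> S \<squnion> a" if s: "s \<in> S" for s
      proof -
        have "s \<sqsubseteq> \<Squnion>\<^bsub>?B\<^esub> S"
          using B.sup_upper[OF S s] by (simp add: up_quantale_sel(2))
        then have "x \<cdot> s \<sqsubseteq> x \<cdot> \<Squnion>\<^bsub>?B\<^esub> S"
          using xA sA[OF s] sup by (intro qmult_mono)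
        then show ?thesis
          using xA sA[OF s] sup a le_join_trans_left[of "x \<cdot> s" "x \<cdot> \<Squnion>\<^bsub>?B\<^esub> S" a]
          by (simp add: join_le_iff join_right)
      qed
      then have "t \<sqsubseteq>\<^bsub>?B\<^esub> x \<cdot> \<Squnion>\<^bsub>?B\<^esub> S \<squnion> a" if "t \<in> ?T" for t
        using that by (auto simp: up_quantale_sel(2,3))
      moreover have "x \<cdot> \<Squnion>\<^bsub>?B\<^esub> S \<squnion> a \<in> carrier ?B"
        using xA sup(1) a by (simp add: up_quantale_sel(1) join_right)
      ultimately have "\<Squnion>\<^bsub>?B\<^esub> ?T \<sqsubseteq>\<^bsub>?B\<^esub> x \<cdot> \<Squnion>\<^bsub>?B\<^esub> S \<squnion> a"
        by (intro B.sup_least[OF T])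
      then show ?thesis
        by (simp only: up_quantale_sel(2))
    qed
    ultimately have "x \<cdot> \<Squnion>\<^bsub>?B\<^esub> S \<squnion> a = \<Squnion>\<^bsub>?B\<^esub> ?T"
      using xA a sup by (intro le_antisym) auto
    then show "x \<cdot>\<^bsub>?B\<^esub> \<Squnion>\<^bsub>?B\<^esub> S = \<Squnion>\<^bsub>?B\<^esub> ?T"
      by (simp add: up_quantale_sel(3))
  qed
qed

text \<open>To test primeness in \<open>A\<close> of a prime of \<open>[a)\<close>, the factors are
  first joined with \<open>a\<close>; conversely, joining a product with \<open>a\<close> does not
  affect being below an element above \<open>a\<close>.\<close>

lemma Spec_up_quantale:
  assumes a: "a \<in> carrier A"
  shows "Spec (up_quantale A a) = V_above A a"
proof -
  let ?B = "up_quantale A a"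
  interpret B: quantale ?B
    using a by (rule quantale_up_quantale)
  note sel = up_quantale_sel
  note top = top_up_quantale[OF a]
  show ?thesis
  proof (intro equalityI subsetI)
    fix p assume p: "p \<in> Spec ?B"
    have pc: "p \<in> carrier A" "a \<sqsubseteq> p"
      using B.Spec_carrier[OF p] by (auto simp: sel)
    have "p \<in> Spec A"
    proof (rule SpecI)
      show "p \<in> carrier A" "\<not> \<top> \<sqsubseteq> p"
        using pc B.top_not_le_Spec[OF p] by (auto simp: sel top)
      fix x y assume xy: "x \<in> carrier A" "y \<in> carrier A" "x \<cdot> y \<sqsubseteq> p"
      have car: "a \<squnion> x \<in> carrier ?B" "a \<squnion> y \<in> carrier ?B"
        using a xy by (auto simp: sel join_left)
      have "(a \<squnion> x) \<cdot> (a \<squnion> y) \<sqsubseteq> a \<squnion> x \<cdot> y"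
        using a xy by (intro qmult_join_join_le)
      moreover have "a \<squnion> x \<cdot> y \<sqsubseteq> p"
        using a xy pc by (intro join_le) auto
      ultimately have "(a \<squnion> x) \<cdot> (a \<squnion> y) \<sqsubseteq> p"
        using le_trans[of "(a \<squnion> x) \<cdot> (a \<squnion> y)" "a \<squnion> x \<cdot> y" p] a xy pc by simp
      then have "(a \<squnion> x) \<cdot>\<^bsub>?B\<^esub> (a \<squnion> y) \<sqsubseteq>\<^bsub>?B\<^esub> p"
        using a xy pc by (simp add: sel join_le_iff)
      then have "a \<squnion> x \<sqsubseteq> p \<or> a \<squnion> y \<sqsubseteq> p"
        using SpecD(3)[OF p car] by (simp add: sel)
      then show "x \<sqsubseteq> p \<or> y \<sqsubseteq> p"
        using a xy pc by (simp add: join_le_iff)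
    qed
    then show "p \<in> V_above A a"
      using pc by (simp add: V_above_def)
  next
    fix p assume "p \<in> V_above A a"
    then have p: "p \<in> Spec A" "a \<sqsubseteq> p"
      by (auto simp: V_above_def)
    have pc: "p \<in> carrier A" using p by (intro Spec_carrier)
    show "p \<in> Spec ?B"
    proof (rule B.SpecI)
      show "p \<in> carrier ?B" "\<not> \<top>\<^bsub>?B\<^esub> \<sqsubseteq>\<^bsub>?B\<^esub> p"
        using pc p(2) top_not_le_Spec[OF p(1)] by (auto simp: sel top)
      fix x y assume xy: "x \<in> carrier ?B" "y \<in> carrier ?B" "x \<cdot>\<^bsub>?B\<^esub> y \<sqsubseteq>\<^bsub>?B\<^esub> p"
      then have xy': "x \<in> carrier A" "y \<in> carrier A" "x \<cdot> y \<squnion> a \<sqsubseteq> p"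
        by (auto simp: sel)
      then have "x \<cdot> y \<sqsubseteq> p"
        using a pc by (simp add: join_le_iff)
      then show "x \<sqsubseteq>\<^bsub>?B\<^esub> p \<or> y \<sqsubseteq>\<^bsub>?B\<^esub> p"
        using SpecD(3)[OF p(1) xy'(1,2)] by (simp add: sel)
    qed
  qed
qed

text \<open>All primes lie above \<open>rho A \<bottom>\<close>, so passing to this up-set loses
  none of them.\<close>

lemma mp_up_quantale_iff: "mp_quantale (up_quantale A (rho A \<bottom>)) \<longleftrightarrow> mp_quantale A"
proof (rule mp_quantale_cong)
  show "quantale (up_quantale A (rho A \<bottom>))"
    by (intro quantale_up_quantale rho_closed)
  have "rho A \<bottom> \<sqsubseteq> p" if "p \<in> Spec A" for p
    using that by (intro rho_le bottom_lower Spec_carrier)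
  then show "Spec (up_quantale A (rho A \<bottom>)) = Spec A"
    by (auto simp: Spec_up_quantale rho_closed V_above_def)
qed (rule up_quantale_sel)

end

theorem theorem8p14:
  fixes A :: "'a quantale_obj"
  assumes "coherent_quantale A"
  shows
    "(mp_quantale A \<longleftrightarrow>
        (\<forall>p \<in> Min_Spec A. \<forall>q \<in> Min_Spec A. p \<noteq> q \<longrightarrow> p \<squnion>\<^bsub>A\<^esub> q = \<top>\<^bsub>A\<^esub>))
   \<and> (mp_quantale A \<longleftrightarrow> mp_frame (radical_frame A))
   \<and> (mp_quantale A \<longleftrightarrow> mp_quantale (up_quantale A (rho A \<bottom>\<^bsub>A\<^esub>)))
   \<and> (mp_quantale A \<longleftrightarrow>
        (\<exists>r. continuous_map (Spec_flat A) (Min_flat A) r \<and> (\<forall>p \<in> Min_Spec A. r p = p)))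
   \<and> (mp_quantale A \<longleftrightarrow> normal_space (Spec_flat A))
   \<and> (mp_quantale A \<longleftrightarrow> (\<forall>p \<in> Min_Spec A. closedin (Spec_flat A) (V_above A p)))"
proof -
  interpret coherent_quantale A
    by (rule assms)
  have "mp_quantale A \<longleftrightarrow>
      (\<exists>r. continuous_map (Spec_flat A) (Min_flat A) r \<and> (\<forall>p \<in> Min_Spec A. r p = p))"
    using mp_imp_retraction retraction_imp_mp by metis
  moreover have "mp_quantale A \<longleftrightarrow> normal_space (Spec_flat A)"
    using mp_imp_normal normal_imp_mp by blast
  moreover have "mp_quantale A \<longleftrightarrow> (\<forall>p \<in> Min_Spec A. closedin (Spec_flat A) (V_above A p))"
    using mp_imp_closedin_V_above closedin_V_above_imp_mp by blast
  ultimately show ?thesis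
    using mp_quantale_iff_comaximal mp_frame_radical_frame_iff mp_up_quantale_iff by blast
qed

end
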